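(* Let $G$ and $H$ be countable groups, and let $G\curvearrowright X$ and $H\curvearrowright Y$ be topologically free continuous actions on compact metrizable spaces which are continuously orbit equivalent. Let $\mathscr{S}$ be a collection of sofic approximations for $G$, and suppose that the action $G\curvearrowright X$ has property $\mathscr{S}$-SC. Let $\Pi$ be a sofic approximation sequence for $G$ consisting of elements of $\mathscr{S}$. Then $$h(H\curvearrowright Y)\ge h_\Pi(G\curvearrowright X),$$ where $h(H\curvearrowright Y)$ is the maximum sofic topological entropy of $H\curvearrowright Y$ and $h_\Pi(G\curvearrowright X)$ is the sofic topological entropy of $G\curvearrowright X$ with respect to $\Pi$.
   Context: All groups are countable and discrete. $\mathcal{F}(G)$ is the collection of nonempty finite subsets of $G$, and $\overline{\mathcal{F}}(G)$ the collection of symmetric finite subsets of $G$ containing $e_G$. A continuous action $G\curvearrowright X$ on a compact metrizable space is topologically free if the set of $x\in X$ with $sx\ne x$ for all $s\in G\setminus\{e_G\}$ is dense. Continuous actions $G\curvearrowright X$ and $H\curvearrowright Y$ on compact metrizable spaces are continuously orbit equivalent if there are a homeomorphism $\Phi:X\to Y$ and continuous maps $\kappa:G\times X\to H$ and $\lambda:H\times Y\to G$ with $\Phi(gx)=\kappa(g,x)\Phi(x)$ and $\Phi^{-1}(ty)=\lambda(t,y)\Phi^{-1}(y)$ for all $g\in G,x\in X,t\in H,y\in Y$. Sofic approximations. For a nonempty finite set $V$, $\mathrm{Sym}(V)$ is its permutation group, $\mathrm{m}$ the uniform probability measure on $V$, and $\rho_{\mathrm{Hamm}}(T,S)=|\{v\in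 V:Tv\ne Sv\}|/|V|$ for $T,S\in V^V$. A sofic approximation for $G$ is a (not necessarily multiplicative) map $\sigma:G\to\mathrm{Sym}(V)$ for some nonempty finite set $V$. It is an $(F,\delta)$-approximation ($F\subseteq G$ finite, $\delta>0$) if $\rho_{\mathrm{Hamm}}(\sigma_{st},\sigma_s\sigma_t)\le\delta$ for all $s,t\in F$ and $\rho_{\mathrm{Hamm}}(\sigma_s,\sigma_t)\ge 1-\delta$ for all distinct $s,t\in F$. A sofic approximation sequence for $G$ is a sequence $\Sigma=\{\sigma_k:G\to\mathrm{Sym}(V_k)\}_{k=1}^\infty$ such that for every finite $F\subseteq G$ and $\delta>0$, $\sigma_k$ is an $(F,\delta)$-approximation for all sufficiently large $k$. Sofic topological entropy. Let $d$ be a compatible metric on $X$. For maps $\varphi,\psi:V\to X$ set $d_2(\varphi,\psi)=\big(\frac1{|V|}\sum_{v\in V}d(\varphi(v),\psi(v))^2\big)^{1/2}$ and $d_\infty(\varphi,\psi)=\max_{v\in V}d(\varphi(v),\psi(v))$. For finite $F\subseteq G$, $\delta>0$ and a sofic approximation $\sigma:G\to\mathrm{Sym}(V)$, $\mathrm{Map}_d(F,\delta,\sigma)$ is the set of all maps $\varphi:V\to X$ with $d_2(\varphi\sigma_g,g\varphi)\le\delta$ for all $g\in F$. $N_\varepsilon(\Omega,\rho)$ is the maximum cardinality of a subset $\Omega_0$ of $\Omega$ with $\rho(\omega_1,\omega_2)\ge\varepsilon$ for all distinct $\omega_1,\omega_2\in\Omega_0$. Then $$h_\Sigma(G\curvearrowright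 X)=\sup_{\varepsilon>0}\inf_F\inf_{\delta>0}\limsup_{k\to\infty}\frac1{|V_k|}\log N_\varepsilon(\mathrm{Map}_d(F,\delta,\sigma_k),d_\infty),$$ with $F$ ranging over finite subsets of $G$ and $\log 0=-\infty$; this does not depend on $d$. The maximum sofic topological entropy is $h(G\curvearrowright X)=\max_\Sigma h_\Sigma(G\curvearrowright X)$ over all sofic approximation sequences $\Sigma$ for $G$ (the maximum exists), and is $-\infty$ by convention if there are none. Property $\mathscr{S}$-SC for a continuous action. The action $G\curvearrowright X$ (with compatible metric $d$, on which the notion does not depend) has property $\mathscr{S}$-SC if for any function $\Upsilon:\mathcal{F}(G)\to[0,\infty)$ there is an $S\in\overline{\mathcal{F}}(G)$ such that for any $T\in\overline{\mathcal{F}}(G)$ there are $C,n\in\mathbb{N}$, $S_1,\dots,S_n\in\overline{\mathcal{F}}(G)$, $F^\sharp\in\mathcal{F}(G)$ and $\delta^\sharp>0$ such that for every good enough sofic approximation $\pi:G\to\mathrm{Sym}(V)$ in $\mathscr{S}$ with $\mathrm{Map}_d(F^\sharp,\delta^\sharp,\pi)\ne\emptyset$ there are subsets $W$ and $\mathcal{V}_j$ ($1\le j\le n$) of $V$ with: (i) $\sum_{j=1}^n\Upsilon(S_j)\mathrm{m}(\mathcal{V}_j)\le 1$; (ii) $\bigcup_{g\in S}\pi_gW=V$; (iii) if $w_1,w_2\in W$ satisfy $\pi_gw_1=w_2$ for some $g\in T$ then $w_1$ and $w_2$ are connected by a path (a tuple $(v_0,\dots,v_l)$ with $v_0=w_1$,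 $v_l=w_2$) of length $1\le l\le C$ in which each edge $(v_{i-1},v_i)$ is of the form $(v,\pi_hv)$ for some $1\le j\le n$, $h\in S_j$ and $v\in\mathcal{V}_j$ with $\pi_hv\in\mathcal{V}_j$. Here "for every good enough $\pi$" means: there are a finite $K\subseteq G$ and $\theta>0$ (depending on the previously chosen data) such that the assertion holds for every $\pi$ that is a $(K,\theta)$-approximation. *)

theory Defs
  imports
    "HOL-Analysis.Analysis"
    "HOL-Algebra.Group_Action"
    "HOL-Combinatorics.Permutations"
begin

definition compatible_metric :: "'x topology \<Rightarrow> ('x \<Rightarrow> 'x \<Rightarrow> real) \<Rightarrow> bool" where
  "compatible_metric X d \<longleftrightarrow>
     Metric_space (topspace X) d \<and> Metric_space.mtopology (topspace X) d = X"

definition continuous_action ::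
    "('g, 'm) monoid_scheme \<Rightarrow> 'x topology \<Rightarrow> ('g \<Rightarrow> 'x \<Rightarrow> 'x) \<Rightarrow> bool" where
  "continuous_action G X \<alpha> \<longleftrightarrow>
     group_action G (topspace X) \<alpha> \<and> (\<forall>g\<in>carrier G. continuous_map X X (\<alpha> g))"

definition topologically_free ::
    "('g, 'm) monoid_scheme \<Rightarrow> 'x topology \<Rightarrow> ('g \<Rightarrow> 'x \<Rightarrow> 'x) \<Rightarrow> bool" where
  "topologically_free G X \<alpha> \<longleftrightarrow>
     X closure_of {x \<in> topspace X. \<forall>s \<in> carrier G - {\<one>\<^bsub>G\<^esub>}. \<alpha> s x \<noteq> x} = topspace X"

definition continuously_orbit_equivalent ::
    "('g, 'm) monoid_scheme \<Rightarrow> 'x topology \<Rightarrow> ('g \<Rightarrow> 'x \<Rightarrow> 'x) \<Rightarrow>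
     ('h, 'n) monoid_scheme \<Rightarrow> 'y topology \<Rightarrow> ('h \<Rightarrow> 'y \<Rightarrow> 'y) \<Rightarrow> bool" where
  "continuously_orbit_equivalent G X \<alpha> H Y \<beta> \<longleftrightarrow>
     (\<exists>\<Phi> \<Psi> \<kappa> \<mu>.
        homeomorphic_maps X Y \<Phi> \<Psi> \<and>
        continuous_map (prod_topology (discrete_topology (carrier G)) X)
                       (discrete_topology (carrier H)) \<kappa> \<and>
        continuous_map (prod_topology (discrete_topology (carrier H)) Y)
                       (discrete_topology (carrier G)) \<mu> \<and>
        (\<forall>g\<in>carrier G. \<forall>x\<in>topspace X. \<Phi> (\<alpha> g x) = \<beta> (\<kappa> (g, x)) (\<Phi> x)) \<and>
        (\<forall>t\<in>carrier H. \<forall>y\<in>topspace Y. \<Psi> (\<beta> t y) = \<alpha> (\<mu> (t, y)) (\<Psi> y)))"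

text \<open>A map from the group to \<open>Sym(V)\<close> is encoded as a pair consisting of \<open>V\<close>, a finite
  nonempty subset of some ambient type, and a function into the permutations of that type which
  fix every point outside \<open>V\<close>. Values off the carrier of the group are irrelevant.\<close>

type_synonym ('g, 'v) approx = "'v set \<times> ('g \<Rightarrow> 'v \<Rightarrow> 'v)"

definition sofic_approx :: "('g, 'm) monoid_scheme \<Rightarrow> ('g, 'v) approx \<Rightarrow> bool" where
  "sofic_approx G = (\<lambda>(V, \<sigma>). finite V \<and> V \<noteq> {} \<and> (\<forall>g\<in>carrier G. \<sigma> g permutes V))"

definition hamm :: "'v set \<Rightarrow> ('v \<Rightarrow> 'v) \<Rightarrow> ('v \<Rightarrow> 'v) \<Rightarrow> real" where
  "hamm V T S = real (card {v\<in>V. T v \<noteq> S v}) / real (card V)"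

definition is_approx ::
    "('g, 'm) monoid_scheme \<Rightarrow> 'g set \<Rightarrow> real \<Rightarrow> ('g, 'v) approx \<Rightarrow> bool" where
  "is_approx G F \<delta> = (\<lambda>(V, \<sigma>). sofic_approx G (V, \<sigma>) \<and>
     (\<forall>s\<in>F. \<forall>t\<in>F. hamm V (\<sigma> (s \<otimes>\<^bsub>G\<^esub> t)) (\<sigma> s \<circ> \<sigma> t) \<le> \<delta>) \<and>
     (\<forall>s\<in>F. \<forall>t\<in>F. s \<noteq> t \<longrightarrow> hamm V (\<sigma> s) (\<sigma> t) \<ge> 1 - \<delta>))"

definition sofic_approx_seq ::
    "('g, 'm) monoid_scheme \<Rightarrow> (nat \<Rightarrow> ('g, 'v) approx) \<Rightarrow> bool" where
  "sofic_approx_seq G \<Sigma> \<longleftrightarrow>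
     (\<forall>k. sofic_approx G (\<Sigma> k)) \<and>
     (\<forall>F \<delta>. finite F \<and> F \<subseteq> carrier G \<and> \<delta> > 0 \<longrightarrow>
        (\<forall>\<^sub>F k in sequentially. is_approx G F \<delta> (\<Sigma> k)))"

definition d2 :: "('x \<Rightarrow> 'x \<Rightarrow> real) \<Rightarrow> 'v set \<Rightarrow> ('v \<Rightarrow> 'x) \<Rightarrow> ('v \<Rightarrow> 'x) \<Rightarrow> real" where
  "d2 d V \<phi> \<psi> = sqrt ((\<Sum>v\<in>V. (d (\<phi> v) (\<psi> v))\<^sup>2) / real (card V))"

definition dinf :: "('x \<Rightarrow> 'x \<Rightarrow> real) \<Rightarrow> 'v set \<Rightarrow> ('v \<Rightarrow> 'x) \<Rightarrow> ('v \<Rightarrow> 'x) \<Rightarrow> real" where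
  "dinf d V \<phi> \<psi> = Max ((\<lambda>v. d (\<phi> v) (\<psi> v)) ` V)"

definition Map_d ::
    "'x topology \<Rightarrow> ('g \<Rightarrow> 'x \<Rightarrow> 'x) \<Rightarrow> ('x \<Rightarrow> 'x \<Rightarrow> real) \<Rightarrow>
     'g set \<Rightarrow> real \<Rightarrow> ('g, 'v) approx \<Rightarrow> ('v \<Rightarrow> 'x) set" where
  "Map_d X \<alpha> d F \<delta> = (\<lambda>(V, \<sigma>).
     {\<phi> \<in> V \<rightarrow>\<^sub>E topspace X. \<forall>g\<in>F. d2 d V (\<phi> \<circ> \<sigma> g) (\<alpha> g \<circ> \<phi>) \<le> \<delta>})"

text \<open>The supremum in \<^typ>\<open>enat\<close> is a maximum whenever the cardinalities are bounded, which
  compactness guarantees in every use below.\<close>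

definition sep_number :: "real \<Rightarrow> 'b set \<Rightarrow> ('b \<Rightarrow> 'b \<Rightarrow> real) \<Rightarrow> enat" where
  "sep_number \<epsilon> \<Omega> \<rho> =
     (SUP \<Omega>0 \<in> {\<Omega>0. \<Omega>0 \<subseteq> \<Omega> \<and> finite \<Omega>0 \<and>
                    (\<forall>\<omega>1\<in>\<Omega>0. \<forall>\<omega>2\<in>\<Omega>0. \<omega>1 \<noteq> \<omega>2 \<longrightarrow> \<rho> \<omega>1 \<omega>2 \<ge> \<epsilon>)}.
        enat (card \<Omega>0))"

definition log_enat :: "enat \<Rightarrow> ereal" where
  "log_enat N = (case N of
       enat n \<Rightarrow> if n = 0 then -\<infinity> else ereal (ln (real n))
     | \<infinity> \<Rightarrow> \<infinity>)"

definition sofic_entropy ::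
    "('g, 'm) monoid_scheme \<Rightarrow> 'x topology \<Rightarrow> ('g \<Rightarrow> 'x \<Rightarrow> 'x) \<Rightarrow> ('x \<Rightarrow> 'x \<Rightarrow> real) \<Rightarrow>
     (nat \<Rightarrow> ('g, 'v) approx) \<Rightarrow> ereal" where
  "sofic_entropy G X \<alpha> d \<Sigma> =
     (SUP \<epsilon> \<in> {0<..}. INF F \<in> {F. finite F \<and> F \<subseteq> carrier G}. INF \<delta> \<in> {0<..}.
        limsup (\<lambda>k. log_enat (sep_number \<epsilon> (Map_d X \<alpha> d F \<delta> (\<Sigma> k)) (dinf d (fst (\<Sigma> k))))
                    / ereal (real (card (fst (\<Sigma> k))))))"

text \<open>The supremum is attained if there is a sofic approximation sequence at all, and is
  \<open>-\<infinity>\<close> otherwise. Entropy is unchanged by relabelling the sets \<open>V\<^sub>k\<close>, so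
  it suffices to let them range over the finite nonempty sets of natural numbers.\<close>

definition max_sofic_entropy ::
    "('g, 'm) monoid_scheme \<Rightarrow> 'x topology \<Rightarrow> ('g \<Rightarrow> 'x \<Rightarrow> 'x) \<Rightarrow> ('x \<Rightarrow> 'x \<Rightarrow> real) \<Rightarrow> ereal" where
  "max_sofic_entropy G X \<alpha> d =
     (SUP \<Sigma> \<in> {\<Sigma> :: nat \<Rightarrow> ('g, nat) approx. sofic_approx_seq G \<Sigma>}. sofic_entropy G X \<alpha> d \<Sigma>)"

definition fin_subsets :: "('g, 'm) monoid_scheme \<Rightarrow> 'g set set" where
  "fin_subsets G = {A. A \<subseteq> carrier G \<and> finite A \<and> A \<noteq> {}}"

definition sym_fin_subsets :: "('g, 'm) monoid_scheme \<Rightarrow> 'g set set" where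
  "sym_fin_subsets G =
     {A. A \<subseteq> carrier G \<and> finite A \<and> \<one>\<^bsub>G\<^esub> \<in> A \<and> (\<forall>g\<in>A. inv\<^bsub>G\<^esub> g \<in> A)}"

definition connected_by_path ::
    "('g \<Rightarrow> 'v \<Rightarrow> 'v) \<Rightarrow> nat \<Rightarrow> (nat \<Rightarrow> 'g set) \<Rightarrow> (nat \<Rightarrow> 'v set) \<Rightarrow> nat \<Rightarrow> 'v \<Rightarrow> 'v \<Rightarrow> bool" where
  "connected_by_path \<pi> n Ss Vs C w1 w2 \<longleftrightarrow>
     (\<exists>l (p :: nat \<Rightarrow> 'v). 1 \<le> l \<and> l \<le> C \<and> p 0 = w1 \<and> p l = w2 \<and>
        (\<forall>i\<in>{1..l}. \<exists>j\<in>{1..n}. \<exists>h\<in>Ss j.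
           p (i - 1) \<in> Vs j \<and> p i = \<pi> h (p (i - 1)) \<and> p i \<in> Vs j))"

definition property_SC ::
    "('g, 'm) monoid_scheme \<Rightarrow> 'x topology \<Rightarrow> ('g \<Rightarrow> 'x \<Rightarrow> 'x) \<Rightarrow> ('x \<Rightarrow> 'x \<Rightarrow> real) \<Rightarrow>
     ('g, 'v) approx set \<Rightarrow> bool" where
  "property_SC G X \<alpha> d \<S> \<longleftrightarrow>
     (\<forall>\<Upsilon> :: 'g set \<Rightarrow> real. (\<forall>A\<in>fin_subsets G. \<Upsilon> A \<ge> 0) \<longrightarrow>
      (\<exists>S\<in>sym_fin_subsets G. \<forall>T\<in>sym_fin_subsets G.
       \<exists>(C::nat) (n::nat) Ss. (\<forall>j\<in>{1..n}. Ss j \<in> sym_fin_subsets G) \<and>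
       (\<exists>F\<in>fin_subsets G. \<exists>\<delta>>0.
        \<exists>K \<theta>. finite K \<and> K \<subseteq> carrier G \<and> \<theta> > 0 \<and>
        (\<forall>(V, \<pi>)\<in>\<S>. is_approx G K \<theta> (V, \<pi>) \<and> Map_d X \<alpha> d F \<delta> (V, \<pi>) \<noteq> {} \<longrightarrow>
          (\<exists>W Vs. W \<subseteq> V \<and> (\<forall>j\<in>{1..n}. Vs j \<subseteq> V) \<and>
             (\<Sum>j=1..n. \<Upsilon> (Ss j) * (real (card (Vs j)) / real (card V))) \<le> 1 \<and>
             (\<Union>g\<in>S. \<pi> g ` W) = V \<and>
             (\<forall>w1\<in>W. \<forall>w2\<in>W. (\<exists>g\<in>T. \<pi> g w1 = w2) \<longrightarrow>
                connected_by_path \<pi> n Ss Vs C w1 w2))))))"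

end

(* Identify Y with X, so that H acts on X by continuous cocycles k(g,x) and l(t,x) over the same
   orbits. A good model phi : V -> X for G turns pi into a map sigma_t v = pi_{l(t, phi v)} v for H,
   but sigma depends on phi, so one has to find many models phi inducing the same sigma.
   With W and the V_j from property SC, choose v = pi_{s_v} w_v with s_v in S and w_v in W.
   Models which take the same values k(h, phi v) for v in V_j and h in S_j have the same cocycle
   along all paths, hence the same connections between points of W; choosing Upsilon proportional
   to the logarithm of the number of such values, there are at most exp(eta |V|) classes.
   Fix phi_0 in a large class, let sigma be induced by phi_0, and replace every phi in the class by
   psi(v) = k(s_v, phi_0(w_v)) phi(w_v). Then psi is a model for sigma, and phi(v), being close
   to s_v phi(w_v), is recovered from psi up to epsilon, uniformly because S was chosen before T. *)
theory Submission
  imports Defs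
begin

text \<open>The naive choice \<open>\<Phi> \<circ> \<phi>\<close> is a model for the approximation
  induced by \<phi> itself, but not for the one induced by \<open>\<phi>0\<close>: moving v by g =
  \<open>l t (\<phi>0 v)\<close> moves its value by \<open>k g (\<phi> v)\<close>, and this is t
  only if \<phi> and \<open>\<phi>0\<close> have the same cocycle there. Prescribing the cocycle at
  all vertices would produce so many classes that the entropy could be lost. Property SC makes it
  cheap to prescribe values on the sets V_j, but these control the cocycle only between points of W.
  So each vertex is carried to W, and the values of \<open>\<phi>0\<close> supply the way back.
  Models are accurate only at most vertices, and the exceptional set varies with the model; hence a
  class also records this set, with approximate values on it. The approximation of H depends on the
  class chosen and cannot be prescribed in advance, which is why the maximum entropy appears on the
  side of H. Freeness enters through the cocycle identities for k and l.\<close>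

section \<open>Counting and permutations\<close>

text \<open>Chernoff bound: weigh \<open>f\<close> by \<open>x\<close> to the power of the size of its support.\<close>

lemma card_sparse_le:
  fixes V :: "'v set" and x \<tau> :: real
  assumes V: "finite V" and x: "0 < x" "x \<le> 1"
  shows "real (card {f \<in> V \<rightarrow>\<^sub>E {..M::nat}. real (card {v\<in>V. f v \<noteq> 0}) \<le> \<tau> * real (card V)})
     \<le> exp (real (card V) * (real M * x + \<tau> * ln (1/x)))"
    (is "real (card ?A) \<le> _")
proof -
  let ?w = "\<lambda>f::'v \<Rightarrow> nat. \<Prod>v\<in>V. if f v = 0 then 1 else x"
  have finP: "finite (V \<rightarrow>\<^sub>E {..M})" using V by (simp add: finite_PiE)
  have w: "?w f = x ^ card {v\<in>V. f v \<noteq> 0}" for f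
    using V by (simp add: prod.If_cases Int_def)
  have ge: "exp (- (\<tau> * real (card V) * ln (1/x))) \<le> ?w f" if "f \<in> ?A" for f
  proof -
    have "?w f = exp (- (real (card {v\<in>V. f v \<noteq> 0}) * ln (1/x)))"
      using x by (simp add: w ln_div exp_of_nat_mult)
    moreover have "real (card {v\<in>V. f v \<noteq> 0}) * ln (1/x) \<le> \<tau> * real (card V) * ln (1/x)"
      using that x by (intro mult_right_mono) auto
    ultimately show ?thesis by simp
  qed
  have "real (card ?A) * exp (- (\<tau> * real (card V) * ln (1/x))) \<le> (\<Sum>f\<in>?A. ?w f)"
    using sum_bounded_below[of ?A, OF ge] by simp
  also have "\<dots> \<le> (\<Sum>f\<in>V \<rightarrow>\<^sub>E {..M}. ?w f)"
    using finP x by (intro sum_mono2) (auto intro!: prod_nonneg)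
  \<comment> \<open>The weight is a product over the vertices, so its sum over all functions
    factors.\<close>
  also have "\<dots> = (\<Prod>v\<in>V. \<Sum>y\<le>M. if y = 0 then 1 else x)"
    using V by (subst prod_sum_PiE) auto
  also have "(\<Sum>y\<le>M. if y = 0 then 1 else x) = 1 + real M * x"
    by (induction M) (auto simp: algebra_simps)
  also have "(\<Prod>v\<in>V. 1 + real M * x) \<le> exp (real M * x) ^ card V"
    using x by (simp add: power_mono)
  also have "\<dots> = exp (real (card V) * (real M * x))"
    by (simp add: exp_of_nat_mult)
  finally have "real (card ?A) * exp (- (\<tau> * real (card V) * ln (1/x))) * exp (\<tau> * real (card V) * ln (1/x))
     \<le> exp (real (card V) * (real M * x)) * exp (\<tau> * real (card V) * ln (1/x))"
    by (intro mult_right_mono) auto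
  then show ?thesis
    by (simp add: mult.assoc flip: exp_add) (simp add: algebra_simps)
qed

text \<open>Each of the two terms of the exponent gets \<eta>/2: \<open>M * x\<close> by the choice
  of x, then \<open>\<tau> * ln (1/x)\<close> by that of \<open>\<tau>0\<close>. Since
  \<open>\<tau>0\<close> depends only on M and \<eta>, the admissible density of bad vertices can be
  fixed before any model is chosen.\<close>

lemma card_sparse_le_exp:
  assumes "\<eta> > 0"
  obtains \<tau>0 :: real where "\<tau>0 > 0"
    "\<And>(V::'v set) \<tau>. \<lbrakk>finite V; \<tau> \<le> \<tau>0\<rbrakk> \<Longrightarrow>
      real (card {f \<in> V \<rightarrow>\<^sub>E {..M::nat}. real (card {v\<in>V. f v \<noteq> 0}) \<le> \<tau> * real (card V)})
       \<le> exp (\<eta> * real (card V))"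
proof -
  \<comment> \<open>The summands 1 here and in \<open>\<tau>0\<close> keep the denominators positive
    when M = 0 or x = 1.\<close>
  define x where "x = min 1 (\<eta> / (2 * (real M + 1)))"
  define \<tau>0 where "\<tau>0 = (\<eta>/2) / (ln (1/x) + 1)"
  have x: "0 < x" "x \<le> 1" using assms by (auto simp: x_def)
  have l: "ln (1/x) \<ge> 0" using x by simp
  have "real M * x \<le> real M * (\<eta> / (2 * (real M + 1)))"
    by (intro mult_left_mono) (auto simp: x_def)
  also have "\<dots> \<le> \<eta> / 2" using assms by (simp add: field_simps)
  finally have 1: "real M * x \<le> \<eta> / 2" .
  have pos: "\<tau>0 > 0" using assms l by (simp add: \<tau>0_def)
  have "\<tau>0 * ln (1/x) \<le> \<tau>0 * (ln (1/x) + 1)"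
    using pos by (intro mult_left_mono) auto
  also have "\<dots> = \<eta> / 2"
    using l unfolding \<tau>0_def by (intro nonzero_eq_divide_eq[THEN iffD1, OF _ refl]) linarith
  finally have 2: "\<tau>0 * ln (1/x) \<le> \<eta> / 2" .
  show ?thesis
  proof (rule that[OF pos])
    fix V :: "'v set" and \<tau> assume V: "finite V" and t: "\<tau> \<le> \<tau>0"
    have "\<tau> * ln (1/x) \<le> \<eta> / 2" using mult_right_mono[OF t l] 2 by linarith
    then have "real (card V) * (real M * x + \<tau> * ln (1/x)) \<le> real (card V) * \<eta>"
      using 1 by (intro mult_left_mono) auto
    then have "exp (real (card V) * (real M * x + \<tau> * ln (1/x))) \<le> exp (\<eta> * real (card V))"
      by (simp add: mult.commute)
    then show "real (card {f \<in> V \<rightarrow>\<^sub>E {..M}. real (card {v\<in>V. f v \<noteq> 0}) \<le> \<tau> * real (card V)})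
       \<le> exp (\<eta> * real (card V))"
      using card_sparse_le[OF V x, of M \<tau>] by linarith
  qed
qed

text \<open>If every fibre were below average size, summing over C would miss elements of \<Omega>;
  values that are not attained have empty fibres, which are below average because \<Omega> is not
  empty. The chosen \<omega>0 becomes the reference model, and C the set of possible
  classes.\<close>

lemma pigeonhole_fibre:
  assumes "finite \<Omega>" "\<Omega> \<noteq> {}" "finite C" "h ` \<Omega> \<subseteq> C"
  obtains \<omega>0 where "\<omega>0 \<in> \<Omega>" "card \<Omega> \<le> card C * card {\<omega>\<in>\<Omega>. h \<omega> = h \<omega>0}"
proof -
  have ne: "C \<noteq> {}" using assms by auto
  have "\<exists>\<omega>0\<in>\<Omega>. card \<Omega> \<le> card C * card {\<omega>\<in>\<Omega>. h \<omega> = h \<omega>0}"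
  proof (rule ccontr)
    assume "\<not> ?thesis"
    then have less: "card C * card {\<omega>\<in>\<Omega>. h \<omega> = h \<omega>0} < card \<Omega>" if "\<omega>0 \<in> \<Omega>" for \<omega>0
      using that by (auto simp: not_le)
    have less': "card C * card {\<omega>\<in>\<Omega>. h \<omega> = c} < card \<Omega>" for c
    proof (cases "c \<in> h ` \<Omega>")
      case True then show ?thesis using less by auto
    next
      case False
      then have "{\<omega>\<in>\<Omega>. h \<omega> = c} = {}" by auto
      then show ?thesis using assms by (simp only: card.empty) (simp add: card_gt_0_iff)
    qed
    have "card \<Omega> = (\<Sum>c\<in>C. card {\<omega>\<in>\<Omega>. h \<omega> = c})"
      using sum_fun_comp[of \<Omega> C h "\<lambda>_. 1::nat"] assms by simp
    then have "card C * card \<Omega> = (\<Sum>c\<in>C. card C * card {\<omega>\<in>\<Omega>. h \<omega> = c})"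
      by (simp add: sum_distrib_left)
    also have "\<dots> < (\<Sum>c\<in>C. card \<Omega>)"
      using assms ne less' by (intro sum_strict_mono) auto
    finally show False by simp
  qed
  then show ?thesis using that by auto
qed

text \<open>The complements of A and of its image have equal size, so any bijection between them
  completes f. The formula for the approximation of H is only known to be injective on good
  vertices; the remaining ones are few and cost little in the Hamming distance.\<close>

lemma permutes_extend_inj_on:
  assumes "finite V" "A \<subseteq> V" "f ` A \<subseteq> V" "inj_on f A"
  obtains p where "p permutes V" "\<And>v. v \<in> A \<Longrightarrow> p v = f v"
proof -
  have "card (V - A) = card (V - f ` A)"
    using assms by (simp add: card_Diff_subset finite_subset card_image)
  then obtain g where g: "bij_betw g (V - A) (V - f ` A)"
    using assms(1) by (meson finite_Diff finite_same_card_bij)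
  define p where "p v = (if v \<in> A then f v else if v \<in> V then g v else v)" for v
  have 1: "bij_betw p A (f ` A)"
    using assms(4) by (simp add: p_def bij_betw_def cong: inj_on_cong image_cong_simp)
  have 2: "bij_betw p (V - A) (V - f ` A)"
    using g by (subst bij_betw_cong[where g = g]) (auto simp: p_def)
  have "bij_betw p (A \<union> (V - A)) (f ` A \<union> (V - f ` A))"
    by (rule bij_betw_combine[OF 1 2]) auto
  moreover have "A \<union> (V - A) = V" "f ` A \<union> (V - f ` A) = V" using assms by auto
  ultimately have "bij_betw p V V" by simp
  then have "p permutes V"
    by (rule bij_imp_permutes) (use assms in \<open>auto simp: p_def\<close>)
  then show ?thesis by (rule that) (simp add: p_def)
qed

section \<open>Mean distance and distance at most vertices\<close>

lemma d2_Markov: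
  assumes V: "finite V" "V \<noteq> {}" and le: "d2 d V \<phi> \<psi> \<le> \<delta>" and r: "0 < r"
  shows "real (card {v\<in>V. \<bar>d (\<phi> v) (\<psi> v)\<bar> \<ge> r}) \<le> \<delta>\<^sup>2 / r\<^sup>2 * real (card V)"
proof -
  let ?B = "{v\<in>V. \<bar>d (\<phi> v) (\<psi> v)\<bar> \<ge> r}"
  have n: "real (card V) > 0" using V by (simp add: card_gt_0_iff)
  have "(\<Sum>v\<in>V. (d (\<phi> v) (\<psi> v))\<^sup>2) / real (card V) = (d2 d V \<phi> \<psi>)\<^sup>2"
    unfolding d2_def by (simp add: sum_nonneg)
  also have "\<dots> \<le> \<delta>\<^sup>2"
    using le by (intro power_mono) (auto simp: d2_def sum_nonneg)
  finally have 1: "(\<Sum>v\<in>V. (d (\<phi> v) (\<psi> v))\<^sup>2) \<le> \<delta>\<^sup>2 * real (card V)"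
    using n by (simp add: field_simps)
  have "real (card ?B) * r\<^sup>2 \<le> (\<Sum>v\<in>?B. (d (\<phi> v) (\<psi> v))\<^sup>2)"
    using sum_bounded_below[of ?B "r\<^sup>2" "\<lambda>v. (d (\<phi> v) (\<psi> v))\<^sup>2"] r
    by (simp add: abs_le_square_iff[symmetric])
  also have "\<dots> \<le> (\<Sum>v\<in>V. (d (\<phi> v) (\<psi> v))\<^sup>2)"
    using V by (intro sum_mono2) auto
  finally show ?thesis using 1 r by (simp add: field_simps)
qed

text \<open>Converse to \<open>d2_Markov\<close>: the bound a on most vertices, and the worst case D
  on the remaining proportion \<tau>.\<close>

lemma d2_le_sqrt:
  assumes V: "finite V" "V \<noteq> {}" and Q: "Q \<subseteq> V" "real (card (V - Q)) \<le> \<tau> * real (card V)"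
    and a: "\<And>v. v \<in> Q \<Longrightarrow> \<bar>d (\<phi> v) (\<psi> v)\<bar> \<le> a"
    and D: "\<And>v. v \<in> V \<Longrightarrow> \<bar>d (\<phi> v) (\<psi> v)\<bar> \<le> D"
  shows "d2 d V \<phi> \<psi> \<le> sqrt (a\<^sup>2 + \<tau> * D\<^sup>2)"
proof -
  have n: "real (card V) > 0" using V by (simp add: card_gt_0_iff)
  have sq: "b\<^sup>2 \<le> c\<^sup>2" if "\<bar>b\<bar> \<le> c" for b c :: real
    using that by (metis abs_ge_zero power2_abs power_mono)
  have "(\<Sum>v\<in>V. (d (\<phi> v) (\<psi> v))\<^sup>2) = (\<Sum>v\<in>V - Q. (d (\<phi> v) (\<psi> v))\<^sup>2) + (\<Sum>v\<in>Q. (d (\<phi> v) (\<psi> v))\<^sup>2)"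
    using V Q by (simp add: sum.subset_diff)
  also have "\<dots> \<le> real (card (V - Q)) * D\<^sup>2 + real (card Q) * a\<^sup>2"
    by (intro add_mono sum_bounded_above sq) (auto intro: a D)
  also have "\<dots> \<le> \<tau> * real (card V) * D\<^sup>2 + real (card V) * a\<^sup>2"
    using V Q by (intro add_mono mult_right_mono) (auto intro: card_mono)
  finally show ?thesis
    unfolding d2_def using n by (intro real_sqrt_le_mono) (simp add: field_simps)
qed

lemma dinf_less_iff:
  assumes "finite V" "V \<noteq> {}"
  shows "dinf d V \<phi> \<psi> < e \<longleftrightarrow> (\<forall>v\<in>V. d (\<phi> v) (\<psi> v) < e)"
  using assms by (simp add: dinf_def)

section \<open>Separated families and entropy\<close>

definition separated_family :: "real \<Rightarrow> ('b \<Rightarrow> 'b \<Rightarrow> real) \<Rightarrow> 'b set \<Rightarrow> bool" where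
  "separated_family \<epsilon> \<rho> \<Omega> \<longleftrightarrow> finite \<Omega> \<and> (\<forall>\<omega>1\<in>\<Omega>. \<forall>\<omega>2\<in>\<Omega>. \<omega>1 \<noteq> \<omega>2 \<longrightarrow> \<epsilon> \<le> \<rho> \<omega>1 \<omega>2)"

lemma le_sep_number:
  assumes "\<Omega>0 \<subseteq> \<Omega>" "separated_family \<epsilon> \<rho> \<Omega>0"
  shows "enat (card \<Omega>0) \<le> sep_number \<epsilon> \<Omega> \<rho>"
  unfolding sep_number_def using assms
  by (intro SUP_upper) (auto simp: separated_family_def)

lemma less_sep_numberE:
  assumes "enat m < sep_number \<epsilon> \<Omega> \<rho>"
  obtains \<Omega>0 where "\<Omega>0 \<subseteq> \<Omega>" "separated_family \<epsilon> \<rho> \<Omega>0" "m < card \<Omega>0"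
proof -
  obtain \<Omega>0 where "\<Omega>0 \<in> {\<Omega>0. \<Omega>0 \<subseteq> \<Omega> \<and> finite \<Omega>0 \<and>
      (\<forall>\<omega>1\<in>\<Omega>0. \<forall>\<omega>2\<in>\<Omega>0. \<omega>1 \<noteq> \<omega>2 \<longrightarrow> \<rho> \<omega>1 \<omega>2 \<ge> \<epsilon>)}" "enat m < enat (card \<Omega>0)"
    using assms unfolding sep_number_def less_SUP_iff by blast
  then show ?thesis by (intro that[of \<Omega>0]) (simp_all add: separated_family_def)
qed

lemma log_enat_ge:
  assumes "enat m \<le> N" "exp r \<le> real m"
  shows "ereal r \<le> log_enat N"
proof (cases N)
  case (enat k)
  have "exp r \<le> real k" using assms enat by simp
  moreover have "k \<noteq> 0"
    using \<open>exp r \<le> real k\<close> exp_gt_zero[of r] by (intro notI) simp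
  ultimately show ?thesis
    using enat by (simp add: log_enat_def ln_ge_iff)
qed (simp add: log_enat_def)

lemma less_log_enat:
  assumes "ereal r < log_enat N" "real m \<le> exp r"
  shows "enat m < N"
proof (cases N)
  case (enat k)
  then have "k \<noteq> 0" "r < ln (real k)"
    using assms(1) by (auto simp: log_enat_def split: if_splits)
  then have "exp r < real k" by (metis exp_less_cancel_iff exp_ln of_nat_0_less_iff neq0_conv)
  then show ?thesis using enat assms(2) by simp
qed simp

text \<open>A number strictly below the supremum fixes one scale \<epsilon> that works against all F
  and \<delta>. Being strictly below a limsup gives infinitely many k, and soficity holds for all
  large k, so some k has both properties.\<close>

lemma less_sofic_entropyD:
  assumes c: "ereal c < sofic_entropy G X \<alpha> d \<Sigma>" and S: "sofic_approx_seq G \<Sigma>"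
  shows "\<exists>\<epsilon>>0. \<forall>F \<delta> K \<theta>. finite F \<and> F \<subseteq> carrier G \<and> \<delta> > 0 \<and> finite K \<and> K \<subseteq> carrier G \<and> \<theta> > 0 \<longrightarrow>
       (\<exists>k \<Omega>. is_approx G K \<theta> (\<Sigma> k) \<and> \<Omega> \<subseteq> Map_d X \<alpha> d F \<delta> (\<Sigma> k) \<and>
         separated_family \<epsilon> (dinf d (fst (\<Sigma> k))) \<Omega> \<and>
         exp (c * real (card (fst (\<Sigma> k)))) < real (card \<Omega>))"
proof -
  let ?N = "\<lambda>\<epsilon> F \<delta> k. sep_number \<epsilon> (Map_d X \<alpha> d F \<delta> (\<Sigma> k)) (dinf d (fst (\<Sigma> k)))"
  let ?n = "\<lambda>k. real (card (fst (\<Sigma> k)))"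
  obtain \<epsilon> where e: "\<epsilon> > 0" and ce: "ereal c <
     (INF F \<in> {F. finite F \<and> F \<subseteq> carrier G}. INF \<delta> \<in> {0<..}. limsup (\<lambda>k. log_enat (?N \<epsilon> F \<delta> k) / ereal (?n k)))"
    using c unfolding sofic_entropy_def less_SUP_iff by auto
  have npos: "?n k > 0" for k
  proof -
    have "sofic_approx G (\<Sigma> k)" using S by (simp add: sofic_approx_seq_def)
    then show ?thesis by (cases "\<Sigma> k") (auto simp: sofic_approx_def card_gt_0_iff)
  qed
  show ?thesis
  proof (intro exI[of _ \<epsilon>] conjI allI impI, rule e, elim conjE)
    fix F \<delta> K \<theta>
    assume F: "finite F" "F \<subseteq> carrier G" "(\<delta>::real) > 0" and K: "finite K" "K \<subseteq> carrier G" "(\<theta>::real) > 0"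
    have "ereal c < limsup (\<lambda>k. log_enat (?N \<epsilon> F \<delta> k) / ereal (?n k))"
      using F by (intro less_le_trans[OF ce] INF_lower2[of F] INF_lower2[of \<delta>]) auto
    then have "\<not> (\<forall>\<^sub>F k in sequentially. log_enat (?N \<epsilon> F \<delta> k) / ereal (?n k) \<le> ereal c)"
    proof (rule contrapos_pn)
      assume "\<forall>\<^sub>F k in sequentially. log_enat (?N \<epsilon> F \<delta> k) / ereal (?n k) \<le> ereal c"
      then have "limsup (\<lambda>k. log_enat (?N \<epsilon> F \<delta> k) / ereal (?n k)) \<le> ereal c"
        by (rule Limsup_bounded)
      then show "\<not> ereal c < limsup (\<lambda>k. log_enat (?N \<epsilon> F \<delta> k) / ereal (?n k))"
        by (simp only: not_less)
    qed
    then have "\<exists>\<^sub>F k in sequentially. ereal c < log_enat (?N \<epsilon> F \<delta> k) / ereal (?n k)"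
      by (simp add: frequently_def not_less)
    moreover have "\<forall>\<^sub>F k in sequentially. is_approx G K \<theta> (\<Sigma> k)"
      using S K by (simp add: sofic_approx_seq_def)
    ultimately have "\<exists>\<^sub>F k in sequentially. ereal c < log_enat (?N \<epsilon> F \<delta> k) / ereal (?n k) \<and> is_approx G K \<theta> (\<Sigma> k)"
      by (elim frequently_rev_mp) (auto elim: eventually_mono)
    then obtain k where k: "ereal c < log_enat (?N \<epsilon> F \<delta> k) / ereal (?n k)" "is_approx G K \<theta> (\<Sigma> k)"
      using frequently_ex by blast
    have l: "ereal (c * ?n k) < log_enat (?N \<epsilon> F \<delta> k)"
      using k(1) npos[of k] by (cases "log_enat (?N \<epsilon> F \<delta> k)") (auto simp: field_simps)
    \<comment> \<open>Rounding down loses nothing: an integer larger than the integer part of a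
      number is larger than the number.\<close>
    define m where "m = nat \<lfloor>exp (c * ?n k)\<rfloor>"
    have "enat m < ?N \<epsilon> F \<delta> k"
      by (rule less_log_enat[OF l]) (simp add: m_def)
    then obtain \<Omega> where O: "\<Omega> \<subseteq> Map_d X \<alpha> d F \<delta> (\<Sigma> k)" "separated_family \<epsilon> (dinf d (fst (\<Sigma> k))) \<Omega>" "m < card \<Omega>"
      by (rule less_sep_numberE)
    have "exp (c * ?n k) < real (card \<Omega>)" using O(3) unfolding m_def by linarith
    with O k show "\<exists>k \<Omega>. is_approx G K \<theta> (\<Sigma> k) \<and> \<Omega> \<subseteq> Map_d X \<alpha> d F \<delta> (\<Sigma> k) \<and>
         separated_family \<epsilon> (dinf d (fst (\<Sigma> k))) \<Omega> \<and>
         exp (c * real (card (fst (\<Sigma> k)))) < real (card \<Omega>)" by blast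
  qed
qed

lemma is_approx_mono:
  assumes "is_approx G F \<delta> A" "F' \<subseteq> F" "\<delta> \<le> \<delta>'"
  shows "is_approx G F' \<delta>' A"
  using assms by (cases A) (simp add: is_approx_def, meson diff_left_mono order_trans subsetD)

lemma Map_d_mono:
  assumes "F' \<subseteq> F" "\<delta> \<le> \<delta>'"
  shows "Map_d X \<alpha> d F \<delta> A \<subseteq> Map_d X \<alpha> d F' \<delta>' A"
  using assms by (cases A) (fastforce simp: Map_d_def)

text \<open>Diagonal choice: exhaust H by finite sets, let the tolerance tend to 0 and take one
  approximation at each stage. By monotonicity in F and \<theta>, the families of late stages serve
  every fixed F and \<delta>. The scale \<epsilon> must be common to all stages, since the supremum
  over \<epsilon> stands outermost in the entropy.\<close>

lemma le_max_sofic_entropy: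
  fixes H :: "('h, 'n) monoid_scheme"
  assumes H: "group H" "countable (carrier H)" and e: "\<epsilon> > 0"
    and ex: "\<And>F \<theta>. \<lbrakk>finite F; F \<subseteq> carrier H; \<theta> > 0\<rbrakk> \<Longrightarrow>
       \<exists>(A::('h, nat) approx) \<Omega>. is_approx H F \<theta> A \<and> \<Omega> \<subseteq> Map_d Y \<beta> d F \<theta> A \<and>
         separated_family \<epsilon> (dinf d (fst A)) \<Omega> \<and>
         exp (c * real (card (fst A))) \<le> real (card \<Omega>)"
  shows "ereal c \<le> max_sofic_entropy H Y \<beta> d"
proof -
  have ne: "carrier H \<noteq> {}" using monoid.one_closed[OF group.is_monoid[OF H(1)]] by blast
  \<comment> \<open>Initial pieces of an enumeration; past the end of a finite group
    \<open>from_nat_into\<close> still takes values in the carrier.\<close>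
  define E where "E m = from_nat_into (carrier H) ` {..m}" for m :: nat
  have E: "finite (E m)" "E m \<subseteq> carrier H" for m
    using ne from_nat_into[OF ne] by (auto simp: E_def)
  have Ex: "\<forall>\<^sub>F m in sequentially. F \<subseteq> E m" if "finite F" "F \<subseteq> carrier H" for F
  proof -
    define m0 where "m0 = Max (insert 0 (to_nat_on (carrier H) ` F))"
    have "x \<in> E m" if "x \<in> F" "m0 \<le> m" for x m
    proof -
      have "to_nat_on (carrier H) x \<le> m0"
        using that \<open>finite F\<close> unfolding m0_def by (intro Max_ge) auto
      moreover have "from_nat_into (carrier H) (to_nat_on (carrier H) x) = x"
        using H that \<open>F \<subseteq> carrier H\<close> by (intro from_nat_into_to_nat_on) auto
      ultimately show ?thesis unfolding E_def using that by (metis atMost_iff image_eqI order_trans)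
    qed
    then show ?thesis by (auto simp: eventually_sequentially)
  qed
  have "\<exists>(A::('h, nat) approx) \<Omega>. is_approx H (E m) (1 / (real m + 1)) A \<and> \<Omega> \<subseteq> Map_d Y \<beta> d (E m) (1 / (real m + 1)) A \<and>
         separated_family \<epsilon> (dinf d (fst A)) \<Omega> \<and>
         exp (c * real (card (fst A))) \<le> real (card \<Omega>)" for m
    by (rule ex) (use E in auto)
  then obtain \<Sigma> :: "nat \<Rightarrow> ('h, nat) approx" and \<Omega> where
    S: "\<And>m. is_approx H (E m) (1 / (real m + 1)) (\<Sigma> m)"
       "\<And>m. \<Omega> m \<subseteq> Map_d Y \<beta> d (E m) (1 / (real m + 1)) (\<Sigma> m)"
       "\<And>m. separated_family \<epsilon> (dinf d (fst (\<Sigma> m))) (\<Omega> m)"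
       "\<And>m. exp (c * real (card (fst (\<Sigma> m)))) \<le> real (card (\<Omega> m))"
    by metis
  have ev: "\<forall>\<^sub>F m in sequentially. 1 / (real m + 1) \<le> \<theta>" if "\<theta> > 0" for \<theta>
  proof -
    have "(\<lambda>m. 1 / (real m + 1)) \<longlonglongrightarrow> 0"
      using LIMSEQ_inverse_real_of_nat by (simp add: inverse_eq_divide add.commute)
    then have "\<forall>\<^sub>F m in sequentially. 1 / (real m + 1) < \<theta>"
      using that by (rule order_tendstoD(2))
    then show ?thesis by eventually_elim simp
  qed
  have so: "sofic_approx H (\<Sigma> m)" for m
    using S(1)[of m] by (cases "\<Sigma> m") (auto simp: is_approx_def)
  have npos: "real (card (fst (\<Sigma> m))) > 0" for m
    using so[of m] by (cases "\<Sigma> m") (auto simp: sofic_approx_def card_gt_0_iff)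
  have seq: "sofic_approx_seq H \<Sigma>"
    unfolding sofic_approx_seq_def
  proof (intro conjI allI impI so)
    fix F \<theta> assume *: "finite F \<and> F \<subseteq> carrier H \<and> (0::real) < \<theta>"
    then have "\<forall>\<^sub>F m in sequentially. F \<subseteq> E m" "\<forall>\<^sub>F m in sequentially. 1 / (real m + 1) \<le> \<theta>"
      using Ex ev by auto
    then show "\<forall>\<^sub>F m in sequentially. is_approx H F \<theta> (\<Sigma> m)"
      by eventually_elim (rule is_approx_mono[OF S(1)])
  qed
  have "ereal c \<le> limsup (\<lambda>k. log_enat (sep_number \<epsilon> (Map_d Y \<beta> d F \<delta> (\<Sigma> k)) (dinf d (fst (\<Sigma> k))))
                    / ereal (real (card (fst (\<Sigma> k)))))" if F: "finite F" "F \<subseteq> carrier H" "\<delta> > 0" for F \<delta>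
  proof -
    have "\<forall>\<^sub>F k in sequentially. ereal c \<le> log_enat (sep_number \<epsilon> (Map_d Y \<beta> d F \<delta> (\<Sigma> k)) (dinf d (fst (\<Sigma> k))))
                    / ereal (real (card (fst (\<Sigma> k))))"
      using Ex[OF F(1,2)] ev[OF F(3)]
    proof eventually_elim
      case (elim k)
      have "\<Omega> k \<subseteq> Map_d Y \<beta> d F \<delta> (\<Sigma> k)"
        using S(2)[of k] Map_d_mono[OF elim] by blast
      from log_enat_ge[OF le_sep_number[OF this S(3)] S(4)]
      show ?case using npos[of k]
        by (cases "log_enat (sep_number \<epsilon> (Map_d Y \<beta> d F \<delta> (\<Sigma> k)) (dinf d (fst (\<Sigma> k))))") (auto simp: field_simps)
    qed
    then have "ereal c \<le> Liminf sequentially (\<lambda>k. log_enat (sep_number \<epsilon> (Map_d Y \<beta> d F \<delta> (\<Sigma> k)) (dinf d (fst (\<Sigma> k))))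
                    / ereal (real (card (fst (\<Sigma> k)))))"
      by (rule Liminf_bounded)
    also have "\<dots> \<le> limsup (\<lambda>k. log_enat (sep_number \<epsilon> (Map_d Y \<beta> d F \<delta> (\<Sigma> k)) (dinf d (fst (\<Sigma> k))))
                    / ereal (real (card (fst (\<Sigma> k)))))"
      by (rule Liminf_le_Limsup) simp
    finally show ?thesis .
  qed
  then have "ereal c \<le> sofic_entropy H Y \<beta> d \<Sigma>"
    unfolding sofic_entropy_def using e by (intro SUP_upper2[of \<epsilon>] INF_greatest) auto
  also have "\<dots> \<le> max_sofic_entropy H Y \<beta> d"
    unfolding max_sofic_entropy_def using seq by (intro SUP_upper) simp
  finally show ?thesis .
qed

section \<open>Relabelling the vertices by natural numbers\<close>

lemma hamm_transport:
  assumes b: "bij_betw b V' V" and f: "\<And>i. i \<in> V' \<Longrightarrow> f' i \<in> V' \<and> b (f' i) = f (b i)"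
    and g: "\<And>i. i \<in> V' \<Longrightarrow> g' i \<in> V' \<and> b (g' i) = g (b i)"
  shows "hamm V' f' g' = hamm V f g"
proof -
  have inj: "inj_on b V'" and im: "b ` V' = V" using b by (auto simp: bij_betw_def)
  have "f' i = g' i \<longleftrightarrow> f (b i) = g (b i)" if "i \<in> V'" for i
    using f[OF that] g[OF that] inj by (metis inj_onD)
  then have "{v\<in>V. f v \<noteq> g v} = b ` {i\<in>V'. f' i \<noteq> g' i}"
    using im by auto
  then have "card {v\<in>V. f v \<noteq> g v} = card {i\<in>V'. f' i \<noteq> g' i}"
    using inj by (simp add: card_image inj_on_subset)
  then show ?thesis using b by (simp add: hamm_def bij_betw_same_card)
qed

text \<open>\<open>max_sofic_entropy\<close> ranges over approximations on sets of natural numbers,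
  whereas the transfer produces them on the vertex sets of the given sequence for G.\<close>

lemma relabel_approx:
  fixes V :: "'v set" and H :: "('h, 'n) monoid_scheme"
  assumes H: "group H" and F: "F \<subseteq> carrier H" and A: "is_approx H F \<theta> (V, \<sigma>)"
    and O: "\<Omega> \<subseteq> Map_d Y \<beta> d F \<delta> (V, \<sigma>)" and sep: "separated_family \<epsilon> (dinf d V) \<Omega>"
  shows "\<exists>(A' :: ('h, nat) approx) \<Omega>'. is_approx H F \<theta> A' \<and> \<Omega>' \<subseteq> Map_d Y \<beta> d F \<delta> A' \<and>
     separated_family \<epsilon> (dinf d (fst A')) \<Omega>' \<and> card (fst A') = card V \<and> card \<Omega>' = card \<Omega>"
proof -
  interpret H: group H by fact
  have V: "finite V" "V \<noteq> {}" and perm: "\<And>t. t \<in> carrier H \<Longrightarrow> \<sigma> t permutes V"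
    using A by (auto simp: is_approx_def sofic_approx_def)
  define V' where "V' = {0..<card V}"
  obtain b where b: "bij_betw b V' V"
    using ex_bij_betw_nat_finite[OF V(1)] by (auto simp: V'_def)
  define a where "a = inv_into V' b"
  have a: "bij_betw a V V'" unfolding a_def by (rule bij_betw_inv_into[OF b])
  have ba: "b (a v) = v" if "v \<in> V" for v
    using b that unfolding a_def by (metis bij_betw_inv_into_right)
  have ab: "a (b i) = i" if "i \<in> V'" for i
    using b that unfolding a_def by (metis bij_betw_inv_into_left)
  have bV: "b i \<in> V" if "i \<in> V'" for i using b that by (auto simp: bij_betw_def)
  have aV: "a v \<in> V'" if "v \<in> V" for v using a that by (auto simp: bij_betw_def)
  \<comment> \<open>The conjugate by b is the identity off V', as \<open>permutes\<close>
    demands.\<close>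
  define \<sigma>' where "\<sigma>' t i = (if i \<in> V' then a (\<sigma> t (b i)) else i)" for t i
  have s': "\<sigma>' t i \<in> V'" "b (\<sigma>' t i) = \<sigma> t (b i)" if "t \<in> carrier H" "i \<in> V'" for t i
    using that bV aV ba permutes_in_image[OF perm[OF that(1)]] by (auto simp: \<sigma>'_def)
  have perm': "\<sigma>' t permutes V'" if t: "t \<in> carrier H" for t
  proof (rule bij_imp_permutes)
    have "bij_betw (a \<circ> \<sigma> t \<circ> b) V' V'"
      using bij_betw_trans[OF bij_betw_trans[OF b permutes_imp_bij[OF perm[OF t]]] a]
      by (simp add: comp_assoc)
    then show "bij_betw (\<sigma>' t) V' V'"
      by (subst bij_betw_cong[where g = "a \<circ> \<sigma> t \<circ> b"]) (auto simp: \<sigma>'_def)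
  qed (simp add: \<sigma>'_def)
  have fin': "finite V'" "V' \<noteq> {}" using V by (auto simp: V'_def card_gt_0_iff)
  have A': "is_approx H F \<theta> (V', \<sigma>')"
  proof -
    have 1: "hamm V' (\<sigma>' (s \<otimes>\<^bsub>H\<^esub> t)) (\<sigma>' s \<circ> \<sigma>' t) = hamm V (\<sigma> (s \<otimes>\<^bsub>H\<^esub> t)) (\<sigma> s \<circ> \<sigma> t)"
      if "s \<in> F" "t \<in> F" for s t
      by (intro hamm_transport[OF b]) (use that F in \<open>auto simp: s' subset_iff\<close>)
    have 2: "hamm V' (\<sigma>' s) (\<sigma>' t) = hamm V (\<sigma> s) (\<sigma> t)" if "s \<in> F" "t \<in> F" for s t
      by (intro hamm_transport[OF b]) (use that F in \<open>auto simp: s' subset_iff\<close>)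
    show ?thesis
      using A fin' perm' by (auto simp: is_approx_def sofic_approx_def 1 2)
  qed
  \<comment> \<open>Members of \<open>Map_d\<close> are extensional: hence the restriction, and
    hence also the injectivity of r below.\<close>
  define r where "r \<phi> = restrict (\<phi> \<circ> b) V'" for \<phi> :: "'v \<Rightarrow> 'a"
  have d2: "d2 d V' (r \<phi> \<circ> \<sigma>' g) (\<beta> g \<circ> r \<phi>) = d2 d V (\<phi> \<circ> \<sigma> g) (\<beta> g \<circ> \<phi>)" if "g \<in> F" for \<phi> g
  proof -
    have "(\<Sum>i\<in>V'. (d ((r \<phi> \<circ> \<sigma>' g) i) ((\<beta> g \<circ> r \<phi>) i))\<^sup>2) =
          (\<Sum>i\<in>V'. (\<lambda>v. (d ((\<phi> \<circ> \<sigma> g) v) ((\<beta> g \<circ> \<phi>) v))\<^sup>2) (b i))"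
      using that F s' by (intro sum.cong) (auto simp: r_def)
    also have "\<dots> = (\<Sum>v\<in>V. (d ((\<phi> \<circ> \<sigma> g) v) ((\<beta> g \<circ> \<phi>) v))\<^sup>2)"
      by (rule sum.reindex_bij_betw[OF b])
    finally show ?thesis using b by (simp add: d2_def bij_betw_same_card)
  qed
  have dinf: "dinf d V' (r \<phi>) (r \<psi>) = dinf d V \<phi> \<psi>" for \<phi> \<psi>
  proof -
    have "(\<lambda>i. d (r \<phi> i) (r \<psi> i)) ` V' = (\<lambda>v. d (\<phi> v) (\<psi> v)) ` (b ` V')"
      by (auto simp: r_def image_image)
    then show ?thesis using b by (simp add: dinf_def bij_betw_def)
  qed
  have "\<Omega> \<subseteq> V \<rightarrow>\<^sub>E topspace Y" using O by (auto simp: Map_d_def)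
  have inj: "inj_on r \<Omega>"
  proof (rule inj_onI)
    fix \<phi> \<psi> assume p: "\<phi> \<in> \<Omega>" "\<psi> \<in> \<Omega>" "r \<phi> = r \<psi>"
    have "\<phi> v = \<psi> v" if "v \<in> V" for v
      using fun_cong[OF p(3), of "a v"] that by (simp add: r_def aV ba)
    then show "\<phi> = \<psi>" using p \<open>\<Omega> \<subseteq> V \<rightarrow>\<^sub>E topspace Y\<close> by (metis PiE_ext subsetD)
  qed
  have "r \<phi> \<in> Map_d Y \<beta> d F \<delta> (V', \<sigma>')" if p: "\<phi> \<in> \<Omega>" for \<phi>
  proof -
    have "\<phi> \<in> V \<rightarrow>\<^sub>E topspace Y" "\<forall>g\<in>F. d2 d V (\<phi> \<circ> \<sigma> g) (\<beta> g \<circ> \<phi>) \<le> \<delta>"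
      using O p by (auto simp: Map_d_def)
    moreover from this(1) have "r \<phi> \<in> V' \<rightarrow>\<^sub>E topspace Y"
      unfolding r_def by (auto simp: bV)
    ultimately show ?thesis by (simp add: Map_d_def d2)
  qed
  then have "r ` \<Omega> \<subseteq> Map_d Y \<beta> d F \<delta> (V', \<sigma>')" by blast
  moreover have "separated_family \<epsilon> (dinf d V') (r ` \<Omega>)"
    using sep by (auto simp: separated_family_def dinf)
  moreover have "card (r ` \<Omega>) = card \<Omega>" using inj by (rule card_image)
  ultimately show ?thesis
    using A' by (intro exI[of _ "(V', \<sigma>')"] exI[of _ "r ` \<Omega>"]) (auto simp: V'_def)
qed

section \<open>Compact metric spaces\<close>

lemma compact_imp_uniformly_continuous_map:
  assumes X: "compact_space X" "compatible_metric X d" and Y: "compatible_metric Y d'"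
    and f: "continuous_map X Y f" and e: "e > 0"
  shows "\<exists>r>0. \<forall>x\<in>topspace X. \<forall>y\<in>topspace X. d x y < r \<longrightarrow> d' (f x) (f y) < e"
proof -
  interpret X: Metric_space "topspace X" d using X by (simp add: compatible_metric_def)
  interpret Y: Metric_space "topspace Y" d' using Y by (simp add: compatible_metric_def)
  have X': "X.mtopology = X" and Y': "Y.mtopology = Y"
    using X Y by (auto simp: compatible_metric_def)
  have "uniformly_continuous_map (metric (topspace X, d)) (metric (topspace Y, d')) f"
    by (rule continuous_imp_uniformly_continuous_map) (simp add: X f X' Y')
  then obtain r where "r > 0"
    and r: "\<forall>x\<in>topspace X. \<forall>y\<in>topspace X. d y x < r \<longrightarrow> d' (f y) (f x) < e"
    using e unfolding uniformly_continuous_map_def X.mspace_metric X.mdist_metric Y.mdist_metric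
    by blast
  then show ?thesis by (intro exI[of _ r]) (simp add: X.commute)
qed

lemma compatible_metric_discrete: "compatible_metric (discrete_topology A) discrete_metric.dd"
  by (simp add: compatible_metric_def discrete_metric.mtopology_discrete_metric metric_M_dd)

text \<open>Heine-Cantor for the discrete metric, where distance below 1 forces equality. It gives
  each cocycle a scale below which it is constant, so that approximate values of a model determine
  exact group elements.\<close>

lemma compact_uniformly_locally_constant:
  assumes X: "compact_space X" "compatible_metric X d"
    and f: "continuous_map X (discrete_topology A) f"
  shows "\<exists>r>0. \<forall>x\<in>topspace X. \<forall>y\<in>topspace X. d x y < r \<longrightarrow> f x = f y"
proof -
  have "\<exists>r>0. \<forall>x\<in>topspace X. \<forall>y\<in>topspace X. d x y < r \<longrightarrow> discrete_metric.dd (f x) (f y) < 1"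
    by (rule compact_imp_uniformly_continuous_map[OF X compatible_metric_discrete f]) simp
  moreover have "discrete_metric.dd a b < 1 \<longleftrightarrow> a = b" for a b :: 'b
    by (simp add: discrete_metric.dd_def)
  ultimately show ?thesis by simp
qed

lemma compact_discrete_image_finite:
  assumes "compact_space X" "continuous_map X (discrete_topology A) f"
  shows "finite (f ` topspace X)"
  using image_compactin[OF assms[unfolded compact_space_def]]
  by (simp add: compactin_discrete_topology)

text \<open>Points are labelled by a ball of radius e/2 that contains them, from a finite cover.
  Labels start at 1 because 0 will mark good vertices when the labels are recorded in a
  class.\<close>

lemma compact_metric_labels:
  assumes X: "compact_space X" "compatible_metric X d" and e: "e > 0"
  obtains M :: nat and lab where
    "\<And>x. x \<in> topspace X \<Longrightarrow> 1 \<le> lab x \<and> lab x \<le> M"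
    "\<And>x y. \<lbrakk>x \<in> topspace X; y \<in> topspace X; lab x = lab y\<rbrakk> \<Longrightarrow> d x y < e"
proof -
  interpret X: Metric_space "topspace X" d using X by (simp add: compatible_metric_def)
  have X': "X.mtopology = X" using X by (auto simp: compatible_metric_def)
  have "X.mtotally_bounded (topspace X)"
    using X X' by (intro X.compactin_imp_mtotally_bounded) (simp add: compact_space_def)
  then obtain K where K: "finite K" "K \<subseteq> topspace X" "topspace X \<subseteq> (\<Union>x\<in>K. X.mball x (e/2))"
    using e unfolding X.mtotally_bounded_def by (meson half_gt_zero)
  obtain h where h: "bij_betw h K {1..card K}"
    using K(1) by (metis One_nat_def card_atLeastAtMost diff_Suc_1 finite_atLeastAtMost finite_same_card_bij)
  have "\<exists>z. z \<in> K \<and> x \<in> X.mball z (e/2)" if "x \<in> topspace X" for x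
    using K(3) that by blast
  then obtain z where z: "\<And>x. x \<in> topspace X \<Longrightarrow> z x \<in> K \<and> x \<in> X.mball (z x) (e/2)" by metis
  show ?thesis
  proof (rule that[of "h \<circ> z" "card K"])
    fix x assume "x \<in> topspace X"
    then show "1 \<le> (h \<circ> z) x \<and> (h \<circ> z) x \<le> card K" using h z by (auto simp: bij_betw_def)
  next
    fix x y assume xy: "x \<in> topspace X" "y \<in> topspace X" "(h \<circ> z) x = (h \<circ> z) y"
    then have "z x = z y" using h z by (auto simp: bij_betw_def dest: inj_onD)
    then have "d (z x) x < e/2" "d (z x) y < e/2" "z x \<in> topspace X"
      using z[OF xy(1)] z[OF xy(2)] by auto
    then show "d x y < e" using X.triangle''[of x "z x" y] xy X.commute by fastforce
  qed
qed

lemma compact_metric_bounded: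
  assumes X: "compact_space X" "compatible_metric X d"
  obtains D where "\<And>x y. \<lbrakk>x \<in> topspace X; y \<in> topspace X\<rbrakk> \<Longrightarrow> d x y \<le> D"
proof -
  interpret X: Metric_space "topspace X" d using X by (simp add: compatible_metric_def)
  have X': "X.mtopology = X" using X by (auto simp: compatible_metric_def)
  have "X.mbounded (topspace X)"
    using X X' by (intro X.compactin_imp_mbounded) (simp add: compact_space_def)
  then show ?thesis using that unfolding X.mbounded_alt by auto
qed

section \<open>The cocycles of a continuous orbit equivalence\<close>

lemma finite_uniform_radius:
  fixes d :: "'a \<Rightarrow> 'x \<Rightarrow> 'x \<Rightarrow> real"
  assumes "finite A"
    and "\<And>a. a \<in> A \<Longrightarrow> \<exists>r>0. \<forall>x\<in>M. \<forall>y\<in>M. d a x y < r \<longrightarrow> P a x y"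
  shows "\<exists>r>0. \<forall>a\<in>A. \<forall>x\<in>M. \<forall>y\<in>M. d a x y < r \<longrightarrow> P a x y"
proof -
  obtain r where r: "\<And>a. a \<in> A \<Longrightarrow> r a > 0 \<and> (\<forall>x\<in>M. \<forall>y\<in>M. d a x y < r a \<longrightarrow> P a x y)"
    using assms(2) by metis
  \<comment> \<open>Inserting 1 keeps the minimum meaningful for empty A.\<close>
  define r0 where "r0 = Min (insert 1 (r ` A))"
  have "r0 > 0" using assms(1) r by (auto simp: r0_def)
  have r0: "r0 \<le> r a" if "a \<in> A" for a
    using assms(1) that by (simp add: r0_def)
  show ?thesis
  proof (intro exI[of _ r0] conjI ballI impI \<open>r0 > 0\<close>)
    fix a x y assume *: "a \<in> A" "x \<in> M" "y \<in> M" "d a x y < r0"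
    then have "d a x y < r a" using r0[of a] by simp
    then show "P a x y" using r * by simp
  qed
qed

locale orbit_equivalence = G: group G + H: group H
  for G :: "('g, 'm) monoid_scheme" and H :: "('h, 'n) monoid_scheme" +
  fixes X :: "'x topology" and Y :: "'y topology"
    and \<alpha> :: "'g \<Rightarrow> 'x \<Rightarrow> 'x" and \<beta> :: "'h \<Rightarrow> 'y \<Rightarrow> 'y"
    and dX :: "'x \<Rightarrow> 'x \<Rightarrow> real" and dY :: "'y \<Rightarrow> 'y \<Rightarrow> real"
    and \<Phi> :: "'x \<Rightarrow> 'y" and \<Psi> :: "'y \<Rightarrow> 'x" and \<kappa> :: "'g \<times> 'x \<Rightarrow> 'h" and \<mu> :: "'h \<times> 'y \<Rightarrow> 'g"
  assumes compact_X: "compact_space X" and metric_X: "compatible_metric X dX"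
    and compact_Y: "compact_space Y" and metric_Y: "compatible_metric Y dY"
    and cont_\<alpha>: "continuous_action G X \<alpha>" and free_\<alpha>: "topologically_free G X \<alpha>"
    and cont_\<beta>: "continuous_action H Y \<beta>" and free_\<beta>: "topologically_free H Y \<beta>"
    and homeo: "homeomorphic_maps X Y \<Phi> \<Psi>"
    and cont_\<kappa>: "continuous_map (prod_topology (discrete_topology (carrier G)) X)
                   (discrete_topology (carrier H)) \<kappa>"
    and cont_\<mu>: "continuous_map (prod_topology (discrete_topology (carrier H)) Y)
                   (discrete_topology (carrier G)) \<mu>"
    and \<Phi>_\<alpha>: "\<And>g x. \<lbrakk>g \<in> carrier G; x \<in> topspace X\<rbrakk> \<Longrightarrow> \<Phi> (\<alpha> g x) = \<beta> (\<kappa> (g, x)) (\<Phi> x)"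
    and \<Psi>_\<beta>: "\<And>t y. \<lbrakk>t \<in> carrier H; y \<in> topspace Y\<rbrakk> \<Longrightarrow> \<Psi> (\<beta> t y) = \<alpha> (\<mu> (t, y)) (\<Psi> y)"

sublocale orbit_equivalence \<subseteq> A: group_action G "topspace X" \<alpha>
  using cont_\<alpha> by (simp add: continuous_action_def)

sublocale orbit_equivalence \<subseteq> B: group_action H "topspace Y" \<beta>
  using cont_\<beta> by (simp add: continuous_action_def)

sublocale orbit_equivalence \<subseteq> X: Metric_space "topspace X" dX
  using metric_X by (simp add: compatible_metric_def)

sublocale orbit_equivalence \<subseteq> Y: Metric_space "topspace Y" dY
  using metric_Y by (simp add: compatible_metric_def)

context orbit_equivalence
begin

text \<open>Both cocycles, also the one for H, are read at points of X; this realises the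
  identification of Y with X while H keeps acting on Y.\<close>

definition k :: "'g \<Rightarrow> 'x \<Rightarrow> 'h" where "k g x = \<kappa> (g, x)"
definition l :: "'h \<Rightarrow> 'x \<Rightarrow> 'g" where "l t x = \<mu> (t, \<Phi> x)"

lemma \<alpha>_closed: "\<lbrakk>g \<in> carrier G; x \<in> topspace X\<rbrakk> \<Longrightarrow> \<alpha> g x \<in> topspace X"
  by (rule A.element_image) auto

lemma \<beta>_closed: "\<lbrakk>t \<in> carrier H; y \<in> topspace Y\<rbrakk> \<Longrightarrow> \<beta> t y \<in> topspace Y"
  by (rule B.element_image) auto

lemma cont_\<Phi>: "continuous_map X Y \<Phi>" and cont_\<Psi>: "continuous_map Y X \<Psi>"
  and \<Psi>_\<Phi>: "x \<in> topspace X \<Longrightarrow> \<Psi> (\<Phi> x) = x" and \<Phi>_\<Psi>: "y \<in> topspace Y \<Longrightarrow> \<Phi> (\<Psi> y) = y"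
  using homeo by (auto simp: homeomorphic_maps_def)

lemma \<Phi>_closed: "x \<in> topspace X \<Longrightarrow> \<Phi> x \<in> topspace Y"
  using continuous_map_image_subset_topspace[OF cont_\<Phi>] by (simp add: image_subset_iff)

lemma \<Psi>_closed: "y \<in> topspace Y \<Longrightarrow> \<Psi> y \<in> topspace X"
  using continuous_map_image_subset_topspace[OF cont_\<Psi>] by (simp add: image_subset_iff)

lemma cont_k: assumes "g \<in> carrier G" shows "continuous_map X (discrete_topology (carrier H)) (k g)"
proof -
  have "continuous_map X (prod_topology (discrete_topology (carrier G)) X) (\<lambda>x. (g, x))"
    using assms by (intro continuous_map_pairedI) auto
  from continuous_map_compose[OF this cont_\<kappa>] show ?thesis
    by (simp add: k_def[abs_def] o_def)
qed

lemma cont_l: assumes "t \<in> carrier H" shows "continuous_map X (discrete_topology (carrier G)) (l t)"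
proof -
  have "continuous_map X (prod_topology (discrete_topology (carrier H)) Y) (\<lambda>x. (t, \<Phi> x))"
    using assms cont_\<Phi> by (intro continuous_map_pairedI) auto
  from continuous_map_compose[OF this cont_\<mu>] show ?thesis
    by (simp add: l_def[abs_def] o_def)
qed

lemma k_closed: "\<lbrakk>g \<in> carrier G; x \<in> topspace X\<rbrakk> \<Longrightarrow> k g x \<in> carrier H"
  using continuous_map_image_subset_topspace[OF cont_k] by (simp add: image_subset_iff)

lemma l_closed: "\<lbrakk>t \<in> carrier H; x \<in> topspace X\<rbrakk> \<Longrightarrow> l t x \<in> carrier G"
  using continuous_map_image_subset_topspace[OF cont_l] by (simp add: image_subset_iff)

lemma finite_k_image: "\<lbrakk>finite A; A \<subseteq> carrier G\<rbrakk> \<Longrightarrow> finite (\<Union>g\<in>A. k g ` topspace X)"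
  using compact_discrete_image_finite[OF compact_X cont_k] by blast

lemma finite_l_image: "\<lbrakk>finite A; A \<subseteq> carrier H\<rbrakk> \<Longrightarrow> finite (\<Union>t\<in>A. l t ` topspace X)"
  using compact_discrete_image_finite[OF compact_X cont_l] by blast

lemma locally_constant_k:
  assumes "finite A" "A \<subseteq> carrier G"
  shows "\<exists>r>0. \<forall>g\<in>A. \<forall>x\<in>topspace X. \<forall>y\<in>topspace X. dX x y < r \<longrightarrow> k g x = k g y"
proof -
  have *: "\<exists>r>0. \<forall>x\<in>topspace X. \<forall>y\<in>topspace X. dX x y < r \<longrightarrow> k g x = k g y" if "g \<in> A" for g
    by (rule compact_uniformly_locally_constant[OF compact_X metric_X cont_k]) (use that assms in auto)
  show ?thesis
    using finite_uniform_radius[OF assms(1) *] .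
qed

lemma locally_constant_l:
  assumes "finite A" "A \<subseteq> carrier H"
  shows "\<exists>r>0. \<forall>t\<in>A. \<forall>x\<in>topspace X. \<forall>y\<in>topspace X. dX x y < r \<longrightarrow> l t x = l t y"
proof -
  have *: "\<exists>r>0. \<forall>x\<in>topspace X. \<forall>y\<in>topspace X. dX x y < r \<longrightarrow> l t x = l t y" if "t \<in> A" for t
    by (rule compact_uniformly_locally_constant[OF compact_X metric_X cont_l]) (use that assms in auto)
  show ?thesis
    using finite_uniform_radius[OF assms(1) *] .
qed

lemma uniform_\<alpha>:
  assumes "finite A" "A \<subseteq> carrier G" "e > 0"
  shows "\<exists>r>0. \<forall>g\<in>A. \<forall>x\<in>topspace X. \<forall>y\<in>topspace X. dX x y < r \<longrightarrow> dX (\<alpha> g x) (\<alpha> g y) < e"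
proof -
  have *: "\<exists>r>0. \<forall>x\<in>topspace X. \<forall>y\<in>topspace X. dX x y < r \<longrightarrow> dX (\<alpha> g x) (\<alpha> g y) < e" if "g \<in> A" for g
    by (rule compact_imp_uniformly_continuous_map[OF compact_X metric_X metric_X])
      (use that assms cont_\<alpha> in \<open>auto simp: continuous_action_def\<close>)
  show ?thesis
    using finite_uniform_radius[OF assms(1) *] .
qed

lemma uniform_\<beta>_\<Phi>:
  assumes "finite A" "A \<subseteq> carrier H" "e > 0"
  shows "\<exists>r>0. \<forall>t\<in>A. \<forall>x\<in>topspace X. \<forall>y\<in>topspace X. dX x y < r \<longrightarrow> dY (\<beta> t (\<Phi> x)) (\<beta> t (\<Phi> y)) < e"
proof -
  have *: "\<exists>r>0. \<forall>x\<in>topspace X. \<forall>y\<in>topspace X. dX x y < r \<longrightarrow> dY (\<beta> t (\<Phi> x)) (\<beta> t (\<Phi> y)) < e" if "t \<in> A" for t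
  proof -
    have "continuous_map X Y (\<beta> t \<circ> \<Phi>)"
      using that assms cont_\<beta> cont_\<Phi> by (auto simp: continuous_action_def intro: continuous_map_compose)
    then show ?thesis
      using compact_imp_uniformly_continuous_map[OF compact_X metric_X metric_Y _ assms(3), of "\<beta> t \<circ> \<Phi>"]
      by simp
  qed
  show ?thesis
    using finite_uniform_radius[OF assms(1) *] .
qed

text \<open>Uniform continuity of the inverse map: \<Psi> after the action of the inverse of t sends
  \<open>\<beta> t (\<Phi> x)\<close> back to x. This is what recovers a model from its transferred
  version.\<close>

lemma uniform_\<beta>_\<Phi>_inverse:
  assumes "finite A" "A \<subseteq> carrier H" "e > 0"
  shows "\<exists>r>0. \<forall>t\<in>A. \<forall>x\<in>topspace X. \<forall>y\<in>topspace X. dY (\<beta> t (\<Phi> x)) (\<beta> t (\<Phi> y)) < r \<longrightarrow> dX x y < e"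
proof -
  have *: "\<exists>r>0. \<forall>x\<in>topspace X. \<forall>y\<in>topspace X. dY (\<beta> t (\<Phi> x)) (\<beta> t (\<Phi> y)) < r \<longrightarrow> dX x y < e" if "t \<in> A" for t
  proof -
    have t: "t \<in> carrier H" using that assms by auto
    have "continuous_map Y X (\<Psi> \<circ> \<beta> (inv\<^bsub>H\<^esub> t))"
      using t cont_\<beta> cont_\<Psi> by (auto simp: continuous_action_def intro: continuous_map_compose)
    then obtain r where r: "r > 0" "\<forall>x\<in>topspace Y. \<forall>y\<in>topspace Y. dY x y < r \<longrightarrow>
        dX ((\<Psi> \<circ> \<beta> (inv\<^bsub>H\<^esub> t)) x) ((\<Psi> \<circ> \<beta> (inv\<^bsub>H\<^esub> t)) y) < e"
      using compact_imp_uniformly_continuous_map[OF compact_Y metric_Y metric_X _ assms(3)] by blast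
    have "(\<Psi> \<circ> \<beta> (inv\<^bsub>H\<^esub> t)) (\<beta> t (\<Phi> x)) = x" if "x \<in> topspace X" for x
      using B.orbit_sym_aux[OF t \<Phi>_closed[OF that] refl] that by (simp add: \<Psi>_\<Phi>)
    then show ?thesis using r t by (intro exI[of _ r]) (metis \<beta>_closed \<Phi>_closed)
  qed
  show ?thesis
    using finite_uniform_radius[OF assms(1) *] .
qed

section \<open>Free points and the cocycle identities\<close>

lemma free_dense_G:
  assumes x: "x \<in> topspace X" and r: "r > 0"
  obtains x' where "x' \<in> topspace X" "dX x x' < r"
    "\<And>a b. \<lbrakk>a \<in> carrier G; b \<in> carrier G; \<alpha> a x' = \<alpha> b x'\<rbrakk> \<Longrightarrow> a = b"
proof -
  let ?S = "{x \<in> topspace X. \<forall>s \<in> carrier G - {\<one>\<^bsub>G\<^esub>}. \<alpha> s x \<noteq> x}"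
  have "X.mtopology = X" using metric_X by (simp add: compatible_metric_def)
  then have "topspace X = X.mtopology closure_of ?S"
    using free_\<alpha> by (simp add: topologically_free_def)
  then have "x \<in> X.mtopology closure_of ?S" using x by simp
  then obtain x' where x': "x' \<in> ?S" "x' \<in> X.mball x r"
    using r unfolding X.metric_closure_of by blast
  have "a = b" if ab: "a \<in> carrier G" "b \<in> carrier G" "\<alpha> a x' = \<alpha> b x'" for a b
  proof -
    have "\<alpha> (inv\<^bsub>G\<^esub> b \<otimes>\<^bsub>G\<^esub> a) x' = \<alpha> (inv\<^bsub>G\<^esub> b) (\<alpha> b x')"
      using ab x' by (simp add: A.composition_rule)
    also have "\<dots> = x'" using A.orbit_sym_aux[OF ab(2) _ refl] x' by simp
    finally have "inv\<^bsub>G\<^esub> b \<otimes>\<^bsub>G\<^esub> a = \<one>\<^bsub>G\<^esub>" using x' ab by blast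
    then show ?thesis using ab by (metis G.inv_closed G.inv_equality G.inv_inv)
  qed
  then show ?thesis using that x' by auto
qed

text \<open>Free points of H are dense in Y, so one is taken near \<open>\<Phi> x\<close> and pulled
  back; r' is the modulus of continuity of \<Psi> for the radius r in X.\<close>

lemma free_dense_H:
  assumes x: "x \<in> topspace X" and r: "r > 0"
  obtains x' where "x' \<in> topspace X" "dX x x' < r"
    "\<And>a b. \<lbrakk>a \<in> carrier H; b \<in> carrier H; \<beta> a (\<Phi> x') = \<beta> b (\<Phi> x')\<rbrakk> \<Longrightarrow> a = b"
proof -
  let ?S = "{x \<in> topspace Y. \<forall>s \<in> carrier H - {\<one>\<^bsub>H\<^esub>}. \<beta> s x \<noteq> x}"
  obtain r' where r': "r' > 0" "\<forall>y\<in>topspace Y. \<forall>y'\<in>topspace Y. dY y y' < r' \<longrightarrow> dX (\<Psi> y) (\<Psi> y') < r"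
    using compact_imp_uniformly_continuous_map[OF compact_Y metric_Y metric_X cont_\<Psi> r] by blast
  have "Y.mtopology = Y" using metric_Y by (simp add: compatible_metric_def)
  then have "topspace Y = Y.mtopology closure_of ?S"
    using free_\<beta> by (simp add: topologically_free_def)
  then have "\<Phi> x \<in> Y.mtopology closure_of ?S" using \<Phi>_closed[OF x] by simp
  then obtain y' where y': "y' \<in> ?S" "y' \<in> Y.mball (\<Phi> x) r'"
    using r' unfolding Y.metric_closure_of by blast
  have "a = b" if ab: "a \<in> carrier H" "b \<in> carrier H" "\<beta> a y' = \<beta> b y'" for a b
  proof -
    have "\<beta> (inv\<^bsub>H\<^esub> b \<otimes>\<^bsub>H\<^esub> a) y' = \<beta> (inv\<^bsub>H\<^esub> b) (\<beta> b y')"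
      using ab y' by (simp add: B.composition_rule)
    also have "\<dots> = y'" using B.orbit_sym_aux[OF ab(2) _ refl] y' by simp
    finally have "inv\<^bsub>H\<^esub> b \<otimes>\<^bsub>H\<^esub> a = \<one>\<^bsub>H\<^esub>" using y' ab by blast
    then show ?thesis using ab by (metis H.inv_closed H.inv_equality H.inv_inv)
  qed
  moreover have "dX x (\<Psi> y') < r"
    using bspec[OF bspec[OF r'(2), of "\<Phi> x"], of y'] y' x by (auto simp: \<Psi>_\<Phi>)
  moreover have "\<Psi> y' \<in> topspace X" "\<Phi> (\<Psi> y') = y'" using y' by (auto simp: \<Phi>_\<Psi> \<Psi>_closed)
  ultimately show ?thesis by (intro that[of "\<Psi> y'"]) simp_all
qed

lemma \<Phi>_\<alpha>_k: "\<lbrakk>g \<in> carrier G; x \<in> topspace X\<rbrakk> \<Longrightarrow> \<Phi> (\<alpha> g x) = \<beta> (k g x) (\<Phi> x)"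
  by (simp add: k_def \<Phi>_\<alpha>)

lemma \<alpha>_l: "\<lbrakk>t \<in> carrier H; x \<in> topspace X\<rbrakk> \<Longrightarrow> \<alpha> (l t x) x = \<Psi> (\<beta> t (\<Phi> x))"
  by (simp add: l_def \<Psi>_\<beta> \<Phi>_closed \<Psi>_\<Phi>)

lemma \<Phi>_\<alpha>_l: "\<lbrakk>t \<in> carrier H; x \<in> topspace X\<rbrakk> \<Longrightarrow> \<Phi> (\<alpha> (l t x) x) = \<beta> t (\<Phi> x)"
  by (simp add: \<alpha>_l \<Phi>_closed \<Phi>_\<Psi> \<beta>_closed)

text \<open>The cocycle identities hold at free points, where group elements are determined by their
  action, and extend to all points since both sides are locally constant.\<close>

lemma k_mult:
  assumes g: "g \<in> carrier G" "h \<in> carrier G" and x: "x \<in> topspace X"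
  shows "k (g \<otimes>\<^bsub>G\<^esub> h) x = k g (\<alpha> h x) \<otimes>\<^bsub>H\<^esub> k h x"
proof -
  have "finite {g, h, g \<otimes>\<^bsub>G\<^esub> h}" "{g, h, g \<otimes>\<^bsub>G\<^esub> h} \<subseteq> carrier G" using g by auto
  from locally_constant_k[OF this] obtain r where r: "r > 0"
    and r_k: "\<And>a x y. \<lbrakk>a \<in> {g, h, g \<otimes>\<^bsub>G\<^esub> h}; x \<in> topspace X; y \<in> topspace X; dX x y < r\<rbrakk> \<Longrightarrow> k a x = k a y"
    by blast
  \<comment> \<open>The free point must be so close to x that also its translate by h stays within r
    of that of x, where \<open>k g\<close> is constant.\<close>
  from uniform_\<alpha>[of "{h}" r] obtain r' where r': "r' > 0"
    and r'_\<alpha>: "\<And>x y. \<lbrakk>x \<in> topspace X; y \<in> topspace X; dX x y < r'\<rbrakk> \<Longrightarrow> dX (\<alpha> h x) (\<alpha> h y) < r"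
    using g r by auto
  obtain x' where x': "x' \<in> topspace X" "dX x x' < min r r'"
    and inj: "\<And>a b. \<lbrakk>a \<in> carrier H; b \<in> carrier H; \<beta> a (\<Phi> x') = \<beta> b (\<Phi> x')\<rbrakk> \<Longrightarrow> a = b"
    by (rule free_dense_H[OF x, of "min r r'"]) (use r r' in auto)
  have hx': "\<alpha> h x' \<in> topspace X" using g x' \<alpha>_closed by auto
  have "\<beta> (k (g \<otimes>\<^bsub>G\<^esub> h) x') (\<Phi> x') = \<Phi> (\<alpha> g (\<alpha> h x'))"
    using g x' by (simp add: \<Phi>_\<alpha>_k[symmetric] A.composition_rule)
  also have "\<dots> = \<beta> (k g (\<alpha> h x')) (\<beta> (k h x') (\<Phi> x'))"
    using g x' hx' by (simp add: \<Phi>_\<alpha>_k)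
  also have "\<dots> = \<beta> (k g (\<alpha> h x') \<otimes>\<^bsub>H\<^esub> k h x') (\<Phi> x')"
    using g x' hx' by (simp add: B.composition_rule k_closed \<Phi>_closed)
  finally have "k (g \<otimes>\<^bsub>G\<^esub> h) x' = k g (\<alpha> h x') \<otimes>\<^bsub>H\<^esub> k h x'"
    using inj g x' hx' by (simp add: k_closed)
  moreover have "k (g \<otimes>\<^bsub>G\<^esub> h) x = k (g \<otimes>\<^bsub>G\<^esub> h) x'" "k h x = k h x'"
    using r_k x x' by auto
  moreover have "k g (\<alpha> h x) = k g (\<alpha> h x')"
    using r_k[of g "\<alpha> h x" "\<alpha> h x'"] r'_\<alpha>[of x x'] x x' hx' g \<alpha>_closed by auto
  ultimately show ?thesis by simp
qed

text \<open>The two sides lie in G, so the comparison is made at a point that is free for G. The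
  translating element \<open>l t x\<close> itself depends on x, but is unchanged at the free point
  by the choice of r; thus both points are moved by the same homeomorphism.\<close>

lemma l_mult:
  assumes t: "s \<in> carrier H" "t \<in> carrier H" and x: "x \<in> topspace X"
  shows "l (s \<otimes>\<^bsub>H\<^esub> t) x = l s (\<alpha> (l t x) x) \<otimes>\<^bsub>G\<^esub> l t x"
proof -
  have "finite {s, t, s \<otimes>\<^bsub>H\<^esub> t}" "{s, t, s \<otimes>\<^bsub>H\<^esub> t} \<subseteq> carrier H" using t by auto
  from locally_constant_l[OF this] obtain r where r: "r > 0"
    and r_l: "\<And>a x y. \<lbrakk>a \<in> {s, t, s \<otimes>\<^bsub>H\<^esub> t}; x \<in> topspace X; y \<in> topspace X; dX x y < r\<rbrakk> \<Longrightarrow> l a x = l a y"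
    by blast
  have g: "l t x \<in> carrier G" using t x l_closed by auto
  from uniform_\<alpha>[of "{l t x}" r] obtain r' where r': "r' > 0"
    and r'_\<alpha>: "\<And>y z. \<lbrakk>y \<in> topspace X; z \<in> topspace X; dX y z < r'\<rbrakk> \<Longrightarrow> dX (\<alpha> (l t x) y) (\<alpha> (l t x) z) < r"
    using g r by auto
  obtain x' where x': "x' \<in> topspace X" "dX x x' < min r r'"
    and inj: "\<And>a b. \<lbrakk>a \<in> carrier G; b \<in> carrier G; \<alpha> a x' = \<alpha> b x'\<rbrakk> \<Longrightarrow> a = b"
    by (rule free_dense_G[OF x, of "min r r'"]) (use r r' in auto)
  have lt: "l t x = l t x'" and lst: "l (s \<otimes>\<^bsub>H\<^esub> t) x = l (s \<otimes>\<^bsub>H\<^esub> t) x'"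
    using r_l x x' by auto
  have y': "\<alpha> (l t x') x' \<in> topspace X" using t x' \<alpha>_closed l_closed by auto
  have "\<alpha> (l (s \<otimes>\<^bsub>H\<^esub> t) x') x' = \<Psi> (\<beta> s (\<beta> t (\<Phi> x')))"
    using t x' by (simp add: \<alpha>_l B.composition_rule \<Phi>_closed)
  also have "\<dots> = \<alpha> (l s (\<alpha> (l t x') x')) (\<alpha> (l t x') x')"
    using t x' y' by (simp add: \<alpha>_l[of s] \<Phi>_\<alpha>_l)
  also have "\<dots> = \<alpha> (l s (\<alpha> (l t x') x') \<otimes>\<^bsub>G\<^esub> l t x') x'"
    using t x' y' by (simp add: A.composition_rule l_closed)
  finally have "l (s \<otimes>\<^bsub>H\<^esub> t) x' = l s (\<alpha> (l t x') x') \<otimes>\<^bsub>G\<^esub> l t x'"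
    using inj t x' y' by (simp add: l_closed)
  moreover have "l s (\<alpha> (l t x) x) = l s (\<alpha> (l t x') x')"
    using r_l[of s "\<alpha> (l t x) x" "\<alpha> (l t x') x'"] r'_\<alpha>[of x x'] x x' y' g \<alpha>_closed lt by auto
  ultimately show ?thesis using lt lst by simp
qed

text \<open>At a free point x' near x both elements of H move \<open>\<Phi> x'\<close> to the same
  place. So \<open>l t x\<close> determines t: this identifies the element of H behind a move by
  \<open>l t x\<close>, and keeps the maps induced by different t apart.\<close>

lemma k_l:
  assumes t: "t \<in> carrier H" and x: "x \<in> topspace X"
  shows "k (l t x) x = t"
proof -
  from locally_constant_l[of "{t}"] obtain r where r: "r > 0"
    and r_l: "\<And>x y. \<lbrakk>x \<in> topspace X; y \<in> topspace X; dX x y < r\<rbrakk> \<Longrightarrow> l t x = l t y"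
    using t by auto
  have g: "l t x \<in> carrier G" using t x l_closed by auto
  from locally_constant_k[of "{l t x}"] obtain r' where r': "r' > 0"
    and r'_k: "\<And>y z. \<lbrakk>y \<in> topspace X; z \<in> topspace X; dX y z < r'\<rbrakk> \<Longrightarrow> k (l t x) y = k (l t x) z"
    using g by auto
  obtain x' where x': "x' \<in> topspace X" "dX x x' < min r r'"
    and inj: "\<And>a b. \<lbrakk>a \<in> carrier H; b \<in> carrier H; \<beta> a (\<Phi> x') = \<beta> b (\<Phi> x')\<rbrakk> \<Longrightarrow> a = b"
    by (rule free_dense_H[OF x, of "min r r'"]) (use r r' in auto)
  have lt: "l t x = l t x'" using r_l x x' by auto
  have "\<beta> (k (l t x) x') (\<Phi> x') = \<beta> t (\<Phi> x')"
    using \<Phi>_\<alpha>_k[OF g x'(1)] \<Phi>_\<alpha>_l[OF t x'(1)] lt by simp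
  then have "k (l t x) x' = t" using inj t g x' by (simp add: k_closed)
  then show ?thesis using r'_k[of x x'] x x' by simp
qed

text \<open>The element fixes x, so \<open>l_mult\<close> makes it idempotent.\<close>

lemma l_one: assumes x: "x \<in> topspace X" shows "l \<one>\<^bsub>H\<^esub> x = \<one>\<^bsub>G\<^esub>"
proof -
  have "\<alpha> (l \<one>\<^bsub>H\<^esub> x) x = x"
    using x by (simp add: \<alpha>_l B.id_eq_one[symmetric] \<Phi>_closed \<Psi>_\<Phi>)
  then show ?thesis
    using l_mult[of "\<one>\<^bsub>H\<^esub>" "\<one>\<^bsub>H\<^esub>" x] x l_closed[of "\<one>\<^bsub>H\<^esub>" x] by (metis G.r_cancel_one' H.l_one H.one_closed)
qed

text \<open>The way back can be read off at the image point. This is the source of the injectivity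
  of the induced maps on vertices.\<close>

lemma l_inv:
  assumes t: "t \<in> carrier H" and x: "x \<in> topspace X"
  shows "l (inv\<^bsub>H\<^esub> t) (\<alpha> (l t x) x) = inv\<^bsub>G\<^esub> (l t x)"
proof -
  have "l (inv\<^bsub>H\<^esub> t) (\<alpha> (l t x) x) \<otimes>\<^bsub>G\<^esub> l t x = \<one>\<^bsub>G\<^esub>"
    using l_mult[of "inv\<^bsub>H\<^esub> t" t x] t x l_one by simp
  then show ?thesis using t x by (metis G.inv_equality H.inv_closed \<alpha>_closed l_closed)
qed

end

section \<open>Models for one group from models for the other\<close>

text \<open>The elements read along a path of exactly i edges; a further edge multiplies on the
  left.\<close>

primrec words :: "('g, 'm) monoid_scheme \<Rightarrow> 'g set \<Rightarrow> nat \<Rightarrow> 'g set" where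
  "words G A 0 = {\<one>\<^bsub>G\<^esub>}"
| "words G A (Suc i) = (\<lambda>(h, q). h \<otimes>\<^bsub>G\<^esub> q) ` (A \<times> words G A i)"

lemma finite_words: "finite A \<Longrightarrow> finite (words G A i)"
  by (induction i) auto

lemma (in group) words_closed: "A \<subseteq> carrier G \<Longrightarrow> words G A i \<subseteq> carrier G"
  by (induction i) auto

lemma card_UN_le_mult:
  assumes "finite I" "\<And>i. i \<in> I \<Longrightarrow> real (card (A i)) \<le> c"
  shows "real (card (\<Union>i\<in>I. A i)) \<le> real (card I) * c"
proof -
  have "real (card (\<Union>i\<in>I. A i)) \<le> (\<Sum>i\<in>I. real (card (A i)))"
    using card_UN_le[OF assms(1), of A] by (metis of_nat_le_iff of_nat_sum)
  also have "\<dots> \<le> real (card I) * c"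
    using assms(2) by (rule sum_bounded_above)
  finally show ?thesis .
qed

section \<open>Vertices where an approximation and a model are accurate\<close>

context orbit_equivalence
begin

text \<open>Gathers at one vertex what \<open>is_approx\<close> and \<open>Map_d\<close> guarantee
  only in the mean. With \<rho> below the scales of constancy of the cocycles, they can be evaluated
  exactly at \<phi> of the E-translates of such a vertex.\<close>

definition good :: "'g set \<Rightarrow> real \<Rightarrow> ('g \<Rightarrow> 'v \<Rightarrow> 'v) \<Rightarrow> ('v \<Rightarrow> 'x) \<Rightarrow> 'v \<Rightarrow> bool" where
  "good E \<rho> \<pi> \<phi> v \<longleftrightarrow>
     (\<forall>g\<in>E. \<forall>h\<in>E. \<pi> (g \<otimes>\<^bsub>G\<^esub> h) v = \<pi> g (\<pi> h v)) \<and>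
     (\<forall>g\<in>E. \<forall>h\<in>E. g \<noteq> h \<longrightarrow> \<pi> g v \<noteq> \<pi> h v) \<and>
     (\<forall>g\<in>E. dX (\<phi> (\<pi> g v)) (\<alpha> g (\<phi> v)) < \<rho>)"

lemma card_not_good_le:
  assumes E: "finite E" and A: "is_approx G E \<theta> (V, \<pi>)" and \<theta>: "\<theta> \<ge> 0"
    and \<phi>: "\<phi> \<in> Map_d X \<alpha> dX E \<delta> (V, \<pi>)" and \<rho>: "\<rho> > 0"
  shows "real (card {v\<in>V. \<not> good E \<rho> \<pi> \<phi> v}) \<le>
    (2 * (real (card E))\<^sup>2 * \<theta> + real (card E) * (\<delta>\<^sup>2 / \<rho>\<^sup>2)) * real (card V)"
proof -
  have V: "finite V" "V \<noteq> {}" and n: "real (card V) > 0"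
    using A by (auto simp: is_approx_def sofic_approx_def card_gt_0_iff)
  define B1 where "B1 = (\<lambda>(g, h). {v\<in>V. \<pi> (g \<otimes>\<^bsub>G\<^esub> h) v \<noteq> (\<pi> g \<circ> \<pi> h) v})"
  define B2 where "B2 = (\<lambda>(g, h). {v\<in>V. g \<noteq> h \<and> \<pi> g v = \<pi> h v})"
  define B3 where "B3 g = {v\<in>V. \<bar>dX ((\<phi> \<circ> \<pi> g) v) ((\<alpha> g \<circ> \<phi>) v)\<bar> \<ge> \<rho>}" for g
  have "{v\<in>V. \<not> good E \<rho> \<pi> \<phi> v} \<subseteq> (\<Union>p\<in>E\<times>E. B1 p) \<union> (\<Union>p\<in>E\<times>E. B2 p) \<union> (\<Union>g\<in>E. B3 g)"
  proof
    fix v assume v: "v \<in> {v\<in>V. \<not> good E \<rho> \<pi> \<phi> v}"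
    then consider g h where "g \<in> E" "h \<in> E" "\<pi> (g \<otimes>\<^bsub>G\<^esub> h) v \<noteq> \<pi> g (\<pi> h v)"
      | g h where "g \<in> E" "h \<in> E" "g \<noteq> h" "\<pi> g v = \<pi> h v"
      | g where "g \<in> E" "\<rho> \<le> dX (\<phi> (\<pi> g v)) (\<alpha> g (\<phi> v))"
      unfolding good_def by force
    then show "v \<in> (\<Union>p\<in>E\<times>E. B1 p) \<union> (\<Union>p\<in>E\<times>E. B2 p) \<union> (\<Union>g\<in>E. B3 g)"
    proof cases
      case 1 then have "v \<in> B1 (g, h)" using v by (simp add: B1_def)
      then show ?thesis using 1 by blast
    next
      case 2 then have "v \<in> B2 (g, h)" using v by (simp add: B2_def)
      then show ?thesis using 2 by blast
    next
      case 3 then have "v \<in> B3 g" using v by (simp add: B3_def)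
      then show ?thesis using 3 by blast
    qed
  qed
  moreover have fin: "finite ((\<Union>p\<in>E\<times>E. B1 p) \<union> (\<Union>p\<in>E\<times>E. B2 p) \<union> (\<Union>g\<in>E. B3 g))"
    by (rule finite_subset[OF _ V(1)]) (auto simp: B1_def B2_def B3_def)
  ultimately have "card {v\<in>V. \<not> good E \<rho> \<pi> \<phi> v} \<le> card ((\<Union>p\<in>E\<times>E. B1 p) \<union> (\<Union>p\<in>E\<times>E. B2 p) \<union> (\<Union>g\<in>E. B3 g))"
    by (intro card_mono)
  also have "\<dots> \<le> card (\<Union>p\<in>E\<times>E. B1 p) + card (\<Union>p\<in>E\<times>E. B2 p) + card (\<Union>g\<in>E. B3 g)"
    by (meson add_le_mono1 card_Un_le le_trans)
  finally have "real (card {v\<in>V. \<not> good E \<rho> \<pi> \<phi> v}) \<le>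
    real (card (\<Union>p\<in>E\<times>E. B1 p)) + real (card (\<Union>p\<in>E\<times>E. B2 p)) + real (card (\<Union>g\<in>E. B3 g))"
    by linarith
  moreover have "real (card (\<Union>p\<in>E\<times>E. B1 p)) \<le> real (card (E\<times>E)) * (\<theta> * real (card V))"
  proof (rule card_UN_le_mult)
    fix p assume "p \<in> E \<times> E"
    then obtain g h where p: "p = (g, h)" "g \<in> E" "h \<in> E" by auto
    then have "hamm V (\<pi> (g \<otimes>\<^bsub>G\<^esub> h)) (\<pi> g \<circ> \<pi> h) \<le> \<theta>" using A by (auto simp: is_approx_def)
    then show "real (card (B1 p)) \<le> \<theta> * real (card V)"
      using n by (simp add: hamm_def B1_def p field_simps)
  qed (use E in simp)
  moreover have "real (card (\<Union>p\<in>E\<times>E. B2 p)) \<le> real (card (E\<times>E)) * (\<theta> * real (card V))"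
  proof (rule card_UN_le_mult)
    fix p assume "p \<in> E \<times> E"
    then obtain g h where p: "p = (g, h)" "g \<in> E" "h \<in> E" by auto
    show "real (card (B2 p)) \<le> \<theta> * real (card V)"
    proof (cases "g = h")
      case True then show ?thesis using \<theta> by (simp add: B2_def p)
    next
      case False
      then have "1 - \<theta> \<le> hamm V (\<pi> g) (\<pi> h)" using A p by (auto simp: is_approx_def)
      then have "real (card V) - \<theta> * real (card V) \<le> real (card {v\<in>V. \<pi> g v \<noteq> \<pi> h v})"
        using n by (simp add: hamm_def field_simps)
      moreover have "B2 p = V - {v\<in>V. \<pi> g v \<noteq> \<pi> h v}" using False by (auto simp: B2_def p)
      then have "real (card (B2 p)) = real (card V) - real (card {v\<in>V. \<pi> g v \<noteq> \<pi> h v})"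
        using V by (simp add: card_Diff_subset card_mono of_nat_diff)
      ultimately show ?thesis by simp
    qed
  qed (use E in simp)
  moreover have "real (card (\<Union>g\<in>E. B3 g)) \<le> real (card E) * (\<delta>\<^sup>2 / \<rho>\<^sup>2 * real (card V))"
    unfolding B3_def
  proof (rule card_UN_le_mult[OF E])
    fix g assume "g \<in> E"
    then have "d2 dX V (\<phi> \<circ> \<pi> g) (\<alpha> g \<circ> \<phi>) \<le> \<delta>" using \<phi> by (auto simp: Map_d_def)
    then show "real (card {v\<in>V. \<rho> \<le> \<bar>dX ((\<phi> \<circ> \<pi> g) v) ((\<alpha> g \<circ> \<phi>) v)\<bar>}) \<le> \<delta>\<^sup>2 / \<rho>\<^sup>2 * real (card V)"
      by (rule d2_Markov[OF V _ \<rho>])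
  qed
  ultimately show ?thesis
    by (simp add: card_cartesian_product power2_eq_square algebra_simps)
qed

lemma k_one: assumes x: "x \<in> topspace X" shows "k \<one>\<^bsub>G\<^esub> x = \<one>\<^bsub>H\<^esub>"
proof -
  have "\<alpha> \<one>\<^bsub>G\<^esub> x = x" using x by (simp add: A.id_eq_one[symmetric])
  then show ?thesis
    using k_mult[of "\<one>\<^bsub>G\<^esub>" "\<one>\<^bsub>G\<^esub>" x] x k_closed[of "\<one>\<^bsub>G\<^esub>" x] by (metis H.r_cancel_one' G.l_one G.one_closed)
qed

end

text \<open>Separates the geometry of one approximation with its reference model
  \<open>\<phi>0\<close> from the choice of constants and from the counting. E holds every element
  of G at which goodness is invoked: values of l, members of S and T, letters, and words of length
  up to C. The element in \<open>q_in_T\<close> carries \<open>w v\<close> to \<open>w u\<close>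
  when u is the image of v under t, with a = \<open>sh v\<close> and b =
  \<open>sh u\<close>.\<close>

locale sofic_transfer = orbit_equivalence G H X Y \<alpha> \<beta> dX dY \<Phi> \<Psi> \<kappa> \<mu>
  for G :: "('g, 'm) monoid_scheme" and H :: "('h, 'n) monoid_scheme"
    and X :: "'x topology" and Y :: "'y topology" and \<alpha> \<beta> dX dY \<Phi> \<Psi> \<kappa> \<mu> +
  fixes V :: "'v set" and \<pi> :: "'g \<Rightarrow> 'v \<Rightarrow> 'v" and E S T :: "'g set" and \<rho> :: real and F :: "'h set"
    and sh :: "'v \<Rightarrow> 'g" and w :: "'v \<Rightarrow> 'v"
    and C n :: nat and Ss :: "nat \<Rightarrow> 'g set" and Vs :: "nat \<Rightarrow> 'v set" and \<phi>0 :: "'v \<Rightarrow> 'x"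
  assumes V: "finite V" "V \<noteq> {}"
    and \<pi>: "\<And>g. g \<in> carrier G \<Longrightarrow> \<pi> g permutes V"
    and E: "E \<subseteq> carrier G" "\<one>\<^bsub>G\<^esub> \<in> E" and S: "S \<subseteq> E" and T: "T \<subseteq> E"
    and F: "F \<subseteq> carrier H" "\<And>t. t \<in> F \<Longrightarrow> inv\<^bsub>H\<^esub> t \<in> F"
    and l_in_E: "\<And>t x. \<lbrakk>t \<in> F; x \<in> topspace X\<rbrakk> \<Longrightarrow> l t x \<in> E"
    and q_in_T: "\<And>t x a b. \<lbrakk>t \<in> F; x \<in> topspace X; a \<in> S; b \<in> S\<rbrakk> \<Longrightarrow> inv\<^bsub>G\<^esub> b \<otimes>\<^bsub>G\<^esub> (l t x \<otimes>\<^bsub>G\<^esub> a) \<in> T"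
    and Ss: "\<And>j. j \<in> {1..n} \<Longrightarrow> Ss j \<subseteq> E"
    and words_in_E: "\<And>i. i \<le> C \<Longrightarrow> words G (\<Union>j\<in>{1..n}. Ss j) i \<subseteq> E"
    and k_const: "\<And>g x y. \<lbrakk>g \<in> S \<union> (\<Union>j\<in>{1..n}. Ss j); x \<in> topspace X; y \<in> topspace X; dX x y < \<rho>\<rbrakk> \<Longrightarrow> k g x = k g y"
    and l_const: "\<And>t x y. \<lbrakk>t \<in> F; x \<in> topspace X; y \<in> topspace X; dX x y < \<rho>\<rbrakk> \<Longrightarrow> l t x = l t y"
    and sh: "\<And>v. v \<in> V \<Longrightarrow> sh v \<in> S" and w: "\<And>v. v \<in> V \<Longrightarrow> w v \<in> V"
    and sh_w: "\<And>v. v \<in> V \<Longrightarrow> \<pi> (sh v) (w v) = v"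
    and paths: "\<And>v u q. \<lbrakk>v \<in> V; u \<in> V; q \<in> T; \<pi> q (w v) = w u\<rbrakk> \<Longrightarrow> connected_by_path \<pi> n Ss Vs C (w v) (w u)"
    and \<phi>0: "\<And>v. v \<in> V \<Longrightarrow> \<phi>0 v \<in> topspace X"
begin

lemma \<pi>_in: assumes "g \<in> E" "v \<in> V" shows "\<pi> g v \<in> V"
  using permutes_in_image[OF \<pi>[OF subsetD[OF E(1) assms(1)]]] assms(2) by simp

lemma \<pi>_inj: assumes "g \<in> E" "\<pi> g v = \<pi> g u" shows "v = u"
  using permutes_inj[OF \<pi>[OF subsetD[OF E(1) assms(1)]]] assms(2) by (rule injD)

lemma good_mult: "\<lbrakk>good E \<rho> \<pi> \<phi> v; g \<in> E; h \<in> E\<rbrakk> \<Longrightarrow> \<pi> (g \<otimes>\<^bsub>G\<^esub> h) v = \<pi> g (\<pi> h v)"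
  by (simp add: good_def)

lemma good_inj: "\<lbrakk>good E \<rho> \<pi> \<phi> v; g \<in> E; h \<in> E; \<pi> g v = \<pi> h v\<rbrakk> \<Longrightarrow> g = h"
  by (auto simp: good_def)

lemma good_dist: "\<lbrakk>good E \<rho> \<pi> \<phi> v; g \<in> E\<rbrakk> \<Longrightarrow> dX (\<phi> (\<pi> g v)) (\<alpha> g (\<phi> v)) < \<rho>"
  by (simp add: good_def)

text \<open>Multiplicativity at the pair of two unit elements, followed by cancellation of a
  permutation.\<close>

lemma good_one: assumes "good E \<rho> \<pi> \<phi> v" shows "\<pi> \<one>\<^bsub>G\<^esub> v = v"
proof -
  have "\<pi> \<one>\<^bsub>G\<^esub> (\<pi> \<one>\<^bsub>G\<^esub> v) = \<pi> \<one>\<^bsub>G\<^esub> v"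
    using good_mult[OF assms E(2) E(2)] by simp
  then show ?thesis by (rule \<pi>_inj[OF E(2)])
qed

lemma k_good:
  assumes "good E \<rho> \<pi> \<phi> v" "\<And>v. v \<in> V \<Longrightarrow> \<phi> v \<in> topspace X" "v \<in> V"
    and "g \<in> E" "h \<in> S \<union> (\<Union>j\<in>{1..n}. Ss j)"
  shows "k h (\<phi> (\<pi> g v)) = k h (\<alpha> g (\<phi> v))"
  using assms E by (intro k_const good_dist) (auto intro!: \<alpha>_closed \<pi>_in)

lemma l_good:
  assumes "good E \<rho> \<pi> \<phi> v" "\<And>v. v \<in> V \<Longrightarrow> \<phi> v \<in> topspace X" "v \<in> V" and "g \<in> E" "t \<in> F"
  shows "l t (\<phi> (\<pi> g v)) = l t (\<alpha> g (\<phi> v))"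
  using assms E by (intro l_const good_dist) (auto intro!: \<alpha>_closed \<pi>_in)

definition agrees :: "('v \<Rightarrow> 'x) \<Rightarrow> bool" where
  "agrees \<phi> \<longleftrightarrow> (\<forall>v\<in>V. \<phi> v \<in> topspace X) \<and>
     (\<forall>j\<in>{1..n}. \<forall>v\<in>Vs j. \<forall>h\<in>Ss j. k h (\<phi> v) = k h (\<phi>0 v))"

text \<open>Induction along the path, writing its i-th point as \<open>\<pi> c v\<close> with a word
  c of length i. In the cocycle identity for a further letter h, the new factor may be evaluated at
  the model's value at \<open>p i\<close>, by goodness of v; there \<phi> and \<open>\<phi>0\<close>
  agree because \<open>p i\<close> lies in the set V_j that belongs to the edge.\<close>

lemma k_eq_along_path:
  assumes \<phi>: "agrees \<phi>" "good E \<rho> \<pi> \<phi> v" "good E \<rho> \<pi> \<phi>0 v" and v: "v \<in> V"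
    and path: "connected_by_path \<pi> n Ss Vs C v u" and q: "q \<in> E" "\<pi> q v = u"
  shows "k q (\<phi> v) = k q (\<phi>0 v)"
proof -
  let ?A = "\<Union>j\<in>{1..n}. Ss j"
  obtain len p where p: "len \<le> C" "p 0 = v" "p len = u"
    and step: "\<And>i. i \<in> {1..len} \<Longrightarrow> \<exists>j\<in>{1..n}. \<exists>h\<in>Ss j. p (i - 1) \<in> Vs j \<and> p i = \<pi> h (p (i - 1)) \<and> p i \<in> Vs j"
    using path unfolding connected_by_path_def by blast
  have inX: "\<And>v. v \<in> V \<Longrightarrow> \<phi> v \<in> topspace X" using \<phi>(1) by (simp add: agrees_def)
  have "\<exists>c\<in>words G ?A i. p i = \<pi> c v \<and> k c (\<phi> v) = k c (\<phi>0 v)" if "i \<le> len" for i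
    using that
  proof (induction i)
    case 0
    then show ?case using good_one[OF \<phi>(2)] p v inX \<phi>0 by (simp add: k_one)
  next
    case (Suc i)
    then obtain c where c: "c \<in> words G ?A i" "p i = \<pi> c v" "k c (\<phi> v) = k c (\<phi>0 v)" by auto
    have cE: "c \<in> E" using words_in_E[of i] c Suc.prems p by auto
    obtain j h where h: "j \<in> {1..n}" "h \<in> Ss j" "p i \<in> Vs j" "p (Suc i) = \<pi> h (p i)"
      using step[of "Suc i"] Suc.prems by auto
    have hA: "h \<in> ?A" and hE: "h \<in> E" using h Ss by blast+
    have "k (h \<otimes>\<^bsub>G\<^esub> c) (\<phi> v) = k h (\<alpha> c (\<phi> v)) \<otimes>\<^bsub>H\<^esub> k c (\<phi> v)"
      using hE cE E inX v by (intro k_mult) auto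
    also have "k h (\<alpha> c (\<phi> v)) = k h (\<phi> (p i))"
      using k_good[OF \<phi>(2) inX v cE, of h] hA c by simp
    also have "\<dots> = k h (\<phi>0 (p i))"
      using \<phi>(1) h unfolding agrees_def by blast
    also have "\<dots> = k h (\<alpha> c (\<phi>0 v))"
      using k_good[OF \<phi>(3) \<phi>0 v cE, of h] hA c by simp
    also have "k c (\<phi> v) = k c (\<phi>0 v)" by fact
    also have "k h (\<alpha> c (\<phi>0 v)) \<otimes>\<^bsub>H\<^esub> k c (\<phi>0 v) = k (h \<otimes>\<^bsub>G\<^esub> c) (\<phi>0 v)"
      using hE cE E \<phi>0 v by (intro k_mult[symmetric]) auto
    finally have "k (h \<otimes>\<^bsub>G\<^esub> c) (\<phi> v) = k (h \<otimes>\<^bsub>G\<^esub> c) (\<phi>0 v)" .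
    moreover have "p (Suc i) = \<pi> (h \<otimes>\<^bsub>G\<^esub> c) v"
      using good_mult[OF \<phi>(2) hE cE] h c by simp
    moreover have "h \<otimes>\<^bsub>G\<^esub> c \<in> words G ?A (Suc i)" using hA c by force
    ultimately show ?case by blast
  qed
  then obtain c where c: "c \<in> words G ?A len" "u = \<pi> c v" "k c (\<phi> v) = k c (\<phi>0 v)"
    using p by blast
  \<comment> \<open>The path fixes only its endpoints; that the word read along it is q follows from
    freeness of \<open>\<pi>\<close> on E at the good vertex v.\<close>
  have "c = q" using good_inj[OF \<phi>(2), of c q] c q words_in_E[OF p(1)] by auto
  then show ?thesis using c by simp
qed

text \<open>Goodness at v serves the construction of \<sigma>, goodness at \<open>w v\<close> the
  comparison of transferred models.\<close>

definition Q :: "'v set" where "Q = {v\<in>V. good E \<rho> \<pi> \<phi>0 v \<and> good E \<rho> \<pi> \<phi>0 (w v)}"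

definition tt :: "'v \<Rightarrow> 'h" where "tt v = k (sh v) (\<phi>0 (w v))"

lemma tt_closed: "v \<in> V \<Longrightarrow> tt v \<in> carrier H"
  unfolding tt_def using sh S E w \<phi>0 by (intro k_closed) auto

text \<open>Only \<open>\<phi> \<circ> w\<close> depends on \<open>\<phi>\<close> here; the group elements are those of \<open>\<phi>0\<close>, so that all models
  agreeing with \<open>\<phi>0\<close> along the paths become models for the same approximation of \<open>H\<close>.\<close>

definition psi :: "('v \<Rightarrow> 'x) \<Rightarrow> 'v \<Rightarrow> 'y" where
  "psi \<phi> = (\<lambda>v\<in>V. \<beta> (tt v) (\<Phi> (\<phi> (w v))))"

text \<open>The point x is the translate of \<open>\<phi> (w v)\<close> by q. The cocycle of q is
  the same for \<phi> as for \<open>\<phi>0\<close>, so an identity between elements of H that is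
  computed for \<open>\<phi>0\<close> alone turns \<open>tt u\<close> at x into t applied to
  \<open>psi \<phi> v\<close>.\<close>

lemma equivariance:
  assumes \<phi>: "agrees \<phi>" "good E \<rho> \<pi> \<phi> (w v)" and v: "v \<in> Q" and t: "t \<in> F"
    and u: "u = \<pi> (l t (\<phi>0 v)) v"
  obtains x where "x \<in> topspace X" "dX (\<phi> (w u)) x < \<rho>" "u \<in> V"
    "\<beta> (tt u) (\<Phi> x) = \<beta> t (psi \<phi> v)"
proof -
  have vV: "v \<in> V" and gv: "good E \<rho> \<pi> \<phi>0 (w v)" using v by (auto simp: Q_def)
  have inX: "\<And>v. v \<in> V \<Longrightarrow> \<phi> v \<in> topspace X" using \<phi>(1) by (simp add: agrees_def)
  define g where "g = l t (\<phi>0 v)"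
  define x0 where "x0 = \<phi>0 (w v)"
  have gE: "g \<in> E" unfolding g_def using t vV \<phi>0 l_in_E by auto
  have uV: "u \<in> V" unfolding u using gE vV \<pi>_in g_def by auto
  \<comment> \<open>Solves \<open>sh u\<close> * q = g * \<open>sh v\<close>, the two routes from
    \<open>w v\<close> to u.\<close>
  define q where "q = inv\<^bsub>G\<^esub> (sh u) \<otimes>\<^bsub>G\<^esub> (g \<otimes>\<^bsub>G\<^esub> sh v)"
  have qT: "q \<in> T" unfolding q_def g_def using t vV uV \<phi>0 sh by (intro q_in_T) auto
  have qE: "q \<in> E" using qT T by auto
  have svE: "sh v \<in> E" and suE: "sh u \<in> E" and svS: "sh v \<in> S" and suS: "sh u \<in> S"
    using sh vV uV S by auto
  have cl: "g \<in> carrier G" "q \<in> carrier G" "sh v \<in> carrier G" "sh u \<in> carrier G"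
    using gE qE svE suE E by auto
  have wv: "w v \<in> V" and wu: "w u \<in> V" using w vV uV by auto
  have x0: "x0 \<in> topspace X" using \<phi>0 wv by (simp add: x0_def)
  have suq: "sh u \<otimes>\<^bsub>G\<^esub> q = g \<otimes>\<^bsub>G\<^esub> sh v"
    unfolding q_def using cl by (simp add: G.m_assoc[symmetric])
  have "\<pi> (sh u) (\<pi> q (w v)) = \<pi> (sh u \<otimes>\<^bsub>G\<^esub> q) (w v)"
    using good_mult[OF gv suE qE] by simp
  also have "\<dots> = \<pi> g (\<pi> (sh v) (w v))"
    using good_mult[OF gv gE svE] suq by simp
  also have "\<dots> = \<pi> (sh u) (w u)" using sh_w vV uV u g_def by simp
  finally have qwv: "\<pi> q (w v) = w u" using \<pi>_inj[OF suE] by blast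
  \<comment> \<open>g was read at \<open>\<phi>0 v\<close>, which is only near the exact translate
    of x0; \<open>l t\<close> has the same value at both.\<close>
  have g': "g = l t (\<alpha> (sh v) x0)"
    using l_good[OF gv \<phi>0 wv svE t] sh_w[OF vV] unfolding g_def x0_def by simp
  have sx: "\<alpha> (sh v) x0 \<in> topspace X" and qx: "\<alpha> q x0 \<in> topspace X" using cl x0 \<alpha>_closed by auto
  have tH: "t \<in> carrier H" using t F by auto
  have ttu: "tt u = k (sh u) (\<alpha> q x0)"
    using k_good[OF gv \<phi>0 wv qE, of "sh u"] qwv suS by (simp add: tt_def x0_def)
  \<comment> \<open>The cocycle at x0 is computed along both routes; on the second one the factor
    belonging to g is t by \<open>k_l\<close>.\<close>
  have "tt u \<otimes>\<^bsub>H\<^esub> k q x0 = k (sh u \<otimes>\<^bsub>G\<^esub> q) x0"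
    unfolding ttu using cl x0 by (intro k_mult[symmetric])
  also have "\<dots> = k g (\<alpha> (sh v) x0) \<otimes>\<^bsub>H\<^esub> k (sh v) x0"
    unfolding suq using cl x0 by (intro k_mult)
  also have "k g (\<alpha> (sh v) x0) = t"
    using k_l[OF tH sx] g' by simp
  finally have main: "tt u \<otimes>\<^bsub>H\<^esub> k q x0 = t \<otimes>\<^bsub>H\<^esub> tt v" by (simp add: tt_def x0_def)
  have kq: "k q (\<phi> (w v)) = k q x0"
    unfolding x0_def
    by (rule k_eq_along_path[OF \<phi> gv wv paths[OF vV uV qT qwv] qE qwv])
  have ax: "\<alpha> q (\<phi> (w v)) \<in> topspace X" using cl inX wv \<alpha>_closed by auto
  have "\<beta> (tt u) (\<Phi> (\<alpha> q (\<phi> (w v)))) = \<beta> (tt u \<otimes>\<^bsub>H\<^esub> k q x0) (\<Phi> (\<phi> (w v)))"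
    using cl inX wv x0 tt_closed[OF uV] kq k_closed
    by (simp add: \<Phi>_\<alpha>_k B.composition_rule \<Phi>_closed)
  also have "\<dots> = \<beta> t (psi \<phi> v)"
    unfolding main psi_def using tH tt_closed[OF vV] inX wv vV
    by (simp add: B.composition_rule \<Phi>_closed)
  finally have "\<beta> (tt u) (\<Phi> (\<alpha> q (\<phi> (w v)))) = \<beta> t (psi \<phi> v)" .
  moreover have "dX (\<phi> (w u)) (\<alpha> q (\<phi> (w v))) < \<rho>"
    using good_dist[OF \<phi>(2) qE] qwv by simp
  ultimately show ?thesis using that ax uV by blast
qed

text \<open>The inverse of t, read at the image vertex, returns the inverse of the element that was
  applied. Equal images thus come from the same g, and \<open>\<pi> g\<close> is injective. This is
  why F is closed under inverses.\<close>

lemma inj_on_orbit_map: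
  assumes t: "t \<in> F" shows "inj_on (\<lambda>v. \<pi> (l t (\<phi>0 v)) v) Q"
proof (rule inj_onI)
  have inv: "l (inv\<^bsub>H\<^esub> t) (\<phi>0 (\<pi> (l t (\<phi>0 v)) v)) = inv\<^bsub>G\<^esub> (l t (\<phi>0 v))" if v: "v \<in> Q" for v
  proof -
    have "v \<in> V" "good E \<rho> \<pi> \<phi>0 v" using v by (auto simp: Q_def)
    then have "l (inv\<^bsub>H\<^esub> t) (\<phi>0 (\<pi> (l t (\<phi>0 v)) v)) = l (inv\<^bsub>H\<^esub> t) (\<alpha> (l t (\<phi>0 v)) (\<phi>0 v))"
      using t F(2) l_in_E \<phi>0 by (intro l_good) auto
    then show ?thesis using l_inv[of t "\<phi>0 v"] t F(1) \<phi>0 \<open>v \<in> V\<close> by auto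
  qed
  fix v u assume vu: "v \<in> Q" "u \<in> Q" "\<pi> (l t (\<phi>0 v)) v = \<pi> (l t (\<phi>0 u)) u"
  have E': "l t (\<phi>0 v) \<in> E" "l t (\<phi>0 u) \<in> E" using vu t l_in_E \<phi>0 by (auto simp: Q_def)
  have "inv\<^bsub>G\<^esub> (l t (\<phi>0 v)) = inv\<^bsub>G\<^esub> (l t (\<phi>0 u))"
    using inv[OF vu(1)] inv[OF vu(2)] vu(3) by simp
  then have "l t (\<phi>0 v) = l t (\<phi>0 u)" using E' E by (metis G.inv_inv subsetD)
  then show "v = u" using vu(3) \<pi>_inj E' by metis
qed

lemma sigma_exists:
  obtains \<sigma> where "\<And>t. \<sigma> t permutes V" "\<And>t v. \<lbrakk>t \<in> F; v \<in> Q\<rbrakk> \<Longrightarrow> \<sigma> t v = \<pi> (l t (\<phi>0 v)) v"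
proof -
  have "\<exists>p. p permutes V \<and> (t \<in> F \<longrightarrow> (\<forall>v\<in>Q. p v = \<pi> (l t (\<phi>0 v)) v))" for t
  proof (cases "t \<in> F")
    case True
    have "(\<lambda>v. \<pi> (l t (\<phi>0 v)) v) ` Q \<subseteq> V"
      using True l_in_E \<phi>0 \<pi>_in by (auto simp: Q_def)
    moreover have "Q \<subseteq> V" by (auto simp: Q_def)
    ultimately obtain p where "p permutes V" "\<And>v. v \<in> Q \<Longrightarrow> p v = \<pi> (l t (\<phi>0 v)) v"
      using permutes_extend_inj_on[OF V(1) _ _ inj_on_orbit_map[OF True]] by blast
    then show ?thesis by blast
  qed (use permutes_id in blast)
  then show ?thesis using that by metis
qed

text \<open>Multiplicativity is the cocycle identity for l wherever both v and its image under t lie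
  in Q; the two exceptional sets have density at most \<tau> each, whence
  \<open>2 * \<tau> \<le> \<theta>\<close>. Freeness holds on all of Q because
  \<open>l t (\<phi>0 v)\<close> determines t.\<close>

lemma is_approx_sigma:
  assumes \<sigma>: "\<And>t. \<sigma> t permutes V" "\<And>t v. \<lbrakk>t \<in> F; v \<in> Q\<rbrakk> \<Longrightarrow> \<sigma> t v = \<pi> (l t (\<phi>0 v)) v"
    and F': "F' \<subseteq> F" "\<And>s t. \<lbrakk>s \<in> F'; t \<in> F'\<rbrakk> \<Longrightarrow> s \<otimes>\<^bsub>H\<^esub> t \<in> F"
    and \<tau>: "real (card (V - Q)) \<le> \<tau> * real (card V)" "2 * \<tau> \<le> \<theta>"
  shows "is_approx H F' \<theta> (V, \<sigma>)"
proof -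
  have n: "real (card V) > 0" using V by (simp add: card_gt_0_iff)
  have QV: "Q \<subseteq> V" by (auto simp: Q_def)
  have \<tau>0: "\<tau> \<ge> 0" using \<tau>(1) n by (meson order_trans of_nat_0_le_iff zero_le_mult_iff not_less less_le_trans)
  have mult: "hamm V (\<sigma> (s \<otimes>\<^bsub>H\<^esub> t)) (\<sigma> s \<circ> \<sigma> t) \<le> \<theta>" if st: "s \<in> F'" "t \<in> F'" for s t
  proof -
    have sH: "s \<in> carrier H" "t \<in> carrier H" "s \<in> F" "t \<in> F" "s \<otimes>\<^bsub>H\<^esub> t \<in> F" using st F F' by auto
    have eq: "\<sigma> (s \<otimes>\<^bsub>H\<^esub> t) v = \<sigma> s (\<sigma> t v)" if v: "v \<in> Q" "\<sigma> t v \<in> Q" for v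
    proof -
      have vV: "v \<in> V" and gv: "good E \<rho> \<pi> \<phi>0 v" using v by (auto simp: Q_def)
      have x: "\<phi>0 v \<in> topspace X" using vV \<phi>0 by auto
      define g where "g = l t (\<phi>0 v)"
      have gE: "g \<in> E" unfolding g_def using sH x l_in_E by auto
      have gx: "\<alpha> g (\<phi>0 v) \<in> topspace X" using gE E x \<alpha>_closed by auto
      have 1: "\<sigma> t v = \<pi> g v" using \<sigma>(2) sH v by (simp add: g_def)
      have "\<sigma> s (\<sigma> t v) = \<pi> (l s (\<phi>0 (\<pi> g v))) (\<pi> g v)" using \<sigma>(2)[OF \<open>s \<in> F\<close> v(2)] 1 by simp
      also have "l s (\<phi>0 (\<pi> g v)) = l s (\<alpha> g (\<phi>0 v))"
        by (rule l_good[OF gv \<phi>0 vV gE \<open>s \<in> F\<close>])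
      also have "\<pi> (l s (\<alpha> g (\<phi>0 v))) (\<pi> g v) = \<pi> (l s (\<alpha> g (\<phi>0 v)) \<otimes>\<^bsub>G\<^esub> g) v"
        using good_mult[OF gv _ gE] l_in_E[OF \<open>s \<in> F\<close> gx] by simp
      also have "l s (\<alpha> g (\<phi>0 v)) \<otimes>\<^bsub>G\<^esub> g = l (s \<otimes>\<^bsub>H\<^esub> t) (\<phi>0 v)"
        unfolding g_def using l_mult[OF sH(1,2) x] by simp
      finally show ?thesis using \<sigma>(2)[OF sH(5) v(1)] by simp
    qed
    have "{v\<in>V. \<sigma> (s \<otimes>\<^bsub>H\<^esub> t) v \<noteq> (\<sigma> s \<circ> \<sigma> t) v} \<subseteq> (V - Q) \<union> {v\<in>V. \<sigma> t v \<in> V - Q}"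
      using eq permutes_in_image[OF \<sigma>(1)] by auto
    then have "card {v\<in>V. \<sigma> (s \<otimes>\<^bsub>H\<^esub> t) v \<noteq> (\<sigma> s \<circ> \<sigma> t) v} \<le> card ((V - Q) \<union> {v\<in>V. \<sigma> t v \<in> V - Q})"
      using V by (intro card_mono) auto
    also have "\<dots> \<le> card (V - Q) + card {v\<in>V. \<sigma> t v \<in> V - Q}" by (rule card_Un_le)
    also have "card {v\<in>V. \<sigma> t v \<in> V - Q} \<le> card (V - Q)"
      using V by (intro card_inj_on_le[where f = "\<sigma> t"] inj_on_subset[OF permutes_inj[OF \<sigma>(1)]]) auto
    finally have "real (card {v\<in>V. \<sigma> (s \<otimes>\<^bsub>H\<^esub> t) v \<noteq> (\<sigma> s \<circ> \<sigma> t) v}) \<le> 2 * \<tau> * real (card V)"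
      using \<tau>(1) by simp
    also have "\<dots> \<le> \<theta> * real (card V)" using \<tau>(2) by (intro mult_right_mono) auto
    finally show ?thesis using n by (simp add: hamm_def field_simps)
  qed
  have free: "1 - \<theta> \<le> hamm V (\<sigma> s) (\<sigma> t)" if st: "s \<in> F'" "t \<in> F'" "s \<noteq> t" for s t
  proof -
    have sH: "s \<in> carrier H" "t \<in> carrier H" "s \<in> F" "t \<in> F" using st F F' by auto
    have "\<sigma> s v \<noteq> \<sigma> t v" if v: "v \<in> Q" for v
    proof
      have vV: "v \<in> V" and gv: "good E \<rho> \<pi> \<phi>0 v" using v by (auto simp: Q_def)
      have x: "\<phi>0 v \<in> topspace X" using vV \<phi>0 by auto
      assume "\<sigma> s v = \<sigma> t v"
      then have "\<pi> (l s (\<phi>0 v)) v = \<pi> (l t (\<phi>0 v)) v" using \<sigma>(2) v sH by simp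
      then have "l s (\<phi>0 v) = l t (\<phi>0 v)" using good_inj[OF gv] l_in_E x sH by blast
      then show False using k_l[OF sH(1) x] k_l[OF sH(2) x] st by simp
    qed
    then have "card Q \<le> card {v\<in>V. \<sigma> s v \<noteq> \<sigma> t v}"
      using V QV by (intro card_mono) auto
    moreover have "real (card (V - Q)) = real (card V) - real (card Q)"
      using V QV by (simp add: card_Diff_subset finite_subset card_mono of_nat_diff)
    moreover have "\<tau> * real (card V) \<le> \<theta> * real (card V)"
      using \<tau>(2) \<tau>0 by (intro mult_right_mono) auto
    ultimately have "real (card V) - \<theta> * real (card V) \<le> real (card {v\<in>V. \<sigma> s v \<noteq> \<sigma> t v})"
      using \<tau>(1) by linarith
    then show ?thesis using n by (simp add: hamm_def field_simps)
  qed
  show ?thesis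
    using V \<sigma>(1) mult free by (simp add: is_approx_def sofic_approx_def)
qed

end

section \<open>The transferred models and their separation\<close>

context sofic_transfer
begin

lemma psi_closed: "\<lbrakk>agrees \<phi>; v \<in> V\<rbrakk> \<Longrightarrow> psi \<phi> v \<in> topspace Y"
  using tt_closed w by (auto simp: psi_def agrees_def intro!: \<beta>_closed \<Phi>_closed)

text \<open>On Q the two values to be compared are the images under one map, \<beta> of
  \<open>tt u\<close> after \<Phi>, of points at distance less than \<rho>. Off Q the diameter bound
  D is used.\<close>

lemma psi_in_Map_d:
  assumes \<sigma>: "\<And>t. \<sigma> t permutes V" "\<And>t v. \<lbrakk>t \<in> F; v \<in> Q\<rbrakk> \<Longrightarrow> \<sigma> t v = \<pi> (l t (\<phi>0 v)) v"
    and F': "F' \<subseteq> F" and \<phi>: "agrees \<phi>" "\<And>v. v \<in> Q \<Longrightarrow> good E \<rho> \<pi> \<phi> (w v)"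
    and unif: "\<And>u x y. \<lbrakk>u \<in> V; x \<in> topspace X; y \<in> topspace X; dX x y < \<rho>\<rbrakk>
        \<Longrightarrow> dY (\<beta> (tt u) (\<Phi> x)) (\<beta> (tt u) (\<Phi> y)) < e"
    and D: "\<And>y y'. \<lbrakk>y \<in> topspace Y; y' \<in> topspace Y\<rbrakk> \<Longrightarrow> dY y y' \<le> D"
    and \<tau>: "real (card (V - Q)) \<le> \<tau> * real (card V)" "sqrt (e\<^sup>2 + \<tau> * D\<^sup>2) \<le> \<delta>"
  shows "psi \<phi> \<in> Map_d Y \<beta> dY F' \<delta> (V, \<sigma>)"
proof -
  have QV: "Q \<subseteq> V" by (auto simp: Q_def)
  have inX: "\<And>v. v \<in> V \<Longrightarrow> \<phi> v \<in> topspace X" using \<phi>(1) by (simp add: agrees_def)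
  have "d2 dY V (psi \<phi> \<circ> \<sigma> t) (\<beta> t \<circ> psi \<phi>) \<le> \<delta>" if t: "t \<in> F'" for t
  proof -
    have tF: "t \<in> F" and tH: "t \<in> carrier H" using t F' F by auto
    have \<sigma>V: "\<sigma> t v \<in> V" if "v \<in> V" for v using permutes_in_image[OF \<sigma>(1)] that by simp
    have "d2 dY V (psi \<phi> \<circ> \<sigma> t) (\<beta> t \<circ> psi \<phi>) \<le> sqrt (e\<^sup>2 + \<tau> * D\<^sup>2)"
    proof (rule d2_le_sqrt[OF V QV \<tau>(1)])
      fix v assume v: "v \<in> Q"
      define u where "u = \<sigma> t v"
      have u: "u = \<pi> (l t (\<phi>0 v)) v" using \<sigma>(2)[OF tF v] by (simp add: u_def)
      obtain x where x: "x \<in> topspace X" "dX (\<phi> (w u)) x < \<rho>" "u \<in> V"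
        "\<beta> (tt u) (\<Phi> x) = \<beta> t (psi \<phi> v)"
        by (rule equivariance[OF \<phi>(1) \<phi>(2)[OF v] v tF u])
      have "dY (psi \<phi> u) (\<beta> t (psi \<phi> v)) < e"
        using unif[OF x(3) inX[OF w[OF x(3)]] x(1,2)] x(3,4) by (simp add: psi_def)
      then show "\<bar>dY ((psi \<phi> \<circ> \<sigma> t) v) ((\<beta> t \<circ> psi \<phi>) v)\<bar> \<le> e"
        by (simp add: u_def)
    next
      fix v assume v: "v \<in> V"
      then show "\<bar>dY ((psi \<phi> \<circ> \<sigma> t) v) ((\<beta> t \<circ> psi \<phi>) v)\<bar> \<le> D"
        using D[OF psi_closed[OF \<phi>(1) \<sigma>V[OF v]] \<beta>_closed[OF tH psi_closed[OF \<phi>(1) v]]] by simp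
    qed
    then show ?thesis using \<tau>(2) by linarith
  qed
  moreover have "psi \<phi> \<in> V \<rightarrow>\<^sub>E topspace Y"
    using psi_closed[OF \<phi>(1)] by (auto simp: psi_def)
  ultimately show ?thesis by (simp add: Map_d_def)
qed

text \<open>On Q closeness passes from psi to the values at \<open>w v\<close>, by undoing
  \<open>tt v\<close>, and then to their translates by \<open>sh v\<close>; replacing these
  translates by the values at v costs \<rho> for each model. This accounts for the three thirds of
  \<epsilon>.\<close>

lemma dinf_less_if_psi_close:
  assumes \<phi>: "agrees \<phi>" "\<And>v. v \<in> Q \<Longrightarrow> good E \<rho> \<pi> \<phi> (w v)"
    and \<psi>: "agrees \<psi>" "\<And>v. v \<in> Q \<Longrightarrow> good E \<rho> \<pi> \<psi> (w v)"
    and inverse: "\<And>u x y. \<lbrakk>u \<in> V; x \<in> topspace X; y \<in> topspace X;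
        dY (\<beta> (tt u) (\<Phi> x)) (\<beta> (tt u) (\<Phi> y)) < e\<rbrakk> \<Longrightarrow> dX x y < r"
    and unif: "\<And>s x y. \<lbrakk>s \<in> S; x \<in> topspace X; y \<in> topspace X; dX x y < r\<rbrakk> \<Longrightarrow> dX (\<alpha> s x) (\<alpha> s y) < \<epsilon> / 3"
    and \<rho>: "\<rho> \<le> \<epsilon> / 3"
    and off: "\<And>v. \<lbrakk>v \<in> V; v \<notin> Q\<rbrakk> \<Longrightarrow> dX (\<phi> v) (\<psi> v) < \<epsilon>"
    and close: "dinf dY V (psi \<phi>) (psi \<psi>) < e"
  shows "dinf dX V \<phi> \<psi> < \<epsilon>"
  unfolding dinf_less_iff[OF V]
proof
  fix v assume v: "v \<in> V"
  show "dX (\<phi> v) (\<psi> v) < \<epsilon>"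
  proof (cases "v \<in> Q")
    case True
    have inX: "\<And>v. v \<in> V \<Longrightarrow> \<phi> v \<in> topspace X" "\<And>v. v \<in> V \<Longrightarrow> \<psi> v \<in> topspace X"
      using \<phi>(1) \<psi>(1) by (auto simp: agrees_def)
    have s: "sh v \<in> S" "sh v \<in> E" "sh v \<in> carrier G" using sh v S E by auto
    have wv: "w v \<in> V" using w v by simp
    have "dY (psi \<phi> v) (psi \<psi> v) < e" using close v unfolding dinf_less_iff[OF V] by blast
    then have "dX (\<phi> (w v)) (\<psi> (w v)) < r"
      using v wv inX by (intro inverse[OF v]) (auto simp: psi_def)
    then have 1: "dX (\<alpha> (sh v) (\<phi> (w v))) (\<alpha> (sh v) (\<psi> (w v))) < \<epsilon> / 3"
      using unif s wv inX by blast
    have 2: "dX (\<phi> v) (\<alpha> (sh v) (\<phi> (w v))) < \<epsilon> / 3" "dX (\<psi> v) (\<alpha> (sh v) (\<psi> (w v))) < \<epsilon> / 3"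
      using good_dist[OF \<phi>(2)[OF True] s(2)] good_dist[OF \<psi>(2)[OF True] s(2)] sh_w[OF v] \<rho> by auto
    have mem: "\<phi> v \<in> topspace X" "\<psi> v \<in> topspace X" "\<alpha> (sh v) (\<phi> (w v)) \<in> topspace X" "\<alpha> (sh v) (\<psi> (w v)) \<in> topspace X"
      using inX v wv s \<alpha>_closed by auto
    have "dX (\<phi> v) (\<psi> v) \<le> dX (\<phi> v) (\<alpha> (sh v) (\<phi> (w v))) + dX (\<alpha> (sh v) (\<phi> (w v))) (\<psi> v)"
      using mem by (intro X.triangle)
    also have "dX (\<alpha> (sh v) (\<phi> (w v))) (\<psi> v) \<le> dX (\<alpha> (sh v) (\<phi> (w v))) (\<alpha> (sh v) (\<psi> (w v))) + dX (\<alpha> (sh v) (\<psi> (w v))) (\<psi> v)"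
      using mem by (intro X.triangle)
    also have "dX (\<alpha> (sh v) (\<psi> (w v))) (\<psi> v) = dX (\<psi> v) (\<alpha> (sh v) (\<psi> (w v)))" by (rule X.commute)
    finally show ?thesis using 1 2 by linarith
  qed (use off v in blast)
qed

end

text \<open>Written as an exponential so that the exponent can be compared with the weighted sum of
  property SC.\<close>

lemma card_PiE_nested:
  assumes "finite J" "\<And>j. j \<in> J \<Longrightarrow> finite (A j) \<and> finite (B j) \<and> card (K j) > 0"
  shows "real (card (PiE J (\<lambda>j. A j \<rightarrow>\<^sub>E (B j \<rightarrow>\<^sub>E K j)))) =
    exp (\<Sum>j\<in>J. real (card (A j)) * (real (card (B j)) * ln (real (card (K j)))))"
proof -
  have "real (card (PiE J (\<lambda>j. A j \<rightarrow>\<^sub>E (B j \<rightarrow>\<^sub>E K j)))) = (\<Prod>j\<in>J. (real (card (K j)) ^ card (B j)) ^ card (A j))"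
    using assms by (simp add: card_PiE cong: prod.cong)
  also have "\<dots> = (\<Prod>j\<in>J. exp (real (card (A j)) * (real (card (B j)) * ln (real (card (K j))))))"
    using assms(2) by (intro prod.cong refl) (simp add: exp_of_nat_mult)
  finally show ?thesis using assms(1) by (simp add: exp_sum)
qed

lemma small_parameters:
  fixes a b \<tau> \<rho> :: real
  assumes "a \<ge> 0" "b \<ge> 0" "\<tau> > 0" "\<rho> > 0"
  obtains \<theta> \<delta> :: real where "\<theta> > 0" "\<delta> > 0" "(1 + b) * (2 * a\<^sup>2 * \<theta> + a * (\<delta>\<^sup>2 / \<rho>\<^sup>2)) \<le> \<tau>"
proof -
  define t where "t = \<tau> / ((1 + b) * (2 * a\<^sup>2 + a + 1))"
  have pos: "(1 + b) * (2 * a\<^sup>2 + a + 1) > 0" using assms by (intro mult_pos_pos) (auto intro: add_nonneg_pos)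
  have t: "t > 0" unfolding t_def using assms pos by (intro divide_pos_pos)
  have "(\<rho> * sqrt t)\<^sup>2 / \<rho>\<^sup>2 = t" using t assms by (simp add: power_mult_distrib)
  then have "(1 + b) * (2 * a\<^sup>2 * t + a * ((\<rho> * sqrt t)\<^sup>2 / \<rho>\<^sup>2)) = (1 + b) * (2 * a\<^sup>2 + a) * t"
    by (simp add: algebra_simps)
  also have "\<dots> \<le> (1 + b) * (2 * a\<^sup>2 + a + 1) * t"
    using assms t by (intro mult_right_mono mult_left_mono) auto
  also have "\<dots> = \<tau>"
    unfolding t_def times_divide_eq_right
    by (rule nonzero_mult_div_cancel_left[OF less_imp_neq[OF pos, THEN not_sym]])
  finally show ?thesis using t assms by (intro that[of t "\<rho> * sqrt t"]) auto
qed

section \<open>Transfer of separated families\<close>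

context orbit_equivalence
begin

text \<open>The order of choices carries the argument: \<eta> determines \<open>\<Upsilon>\<close>,
  property SC returns S, and S with \<epsilon> fixes the new scale. Only then do the accuracy
  demands for H enter, and with them T and every finer constant.\<close>

lemma transfer_separated_families:
  fixes \<S> :: "('g, 'v) approx set"
  assumes SC: "property_SC G X \<alpha> dX \<S>" and \<epsilon>: "\<epsilon> > 0" and \<eta>: "\<eta> > 0"
    and many: "\<And>F \<delta> K \<theta>. \<lbrakk>finite F; F \<subseteq> carrier G; \<delta> > 0; finite K; K \<subseteq> carrier G; \<theta> > 0\<rbrakk> \<Longrightarrow>
       \<exists>V \<pi> \<Omega>. (V, \<pi>) \<in> \<S> \<and> is_approx G K \<theta> (V, \<pi>) \<and> \<Omega> \<subseteq> Map_d X \<alpha> dX F \<delta> (V, \<pi>) \<and>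
         separated_family \<epsilon> (dinf dX V) \<Omega> \<and> exp (c * real (card V)) < real (card \<Omega>)"
  shows "\<exists>\<epsilon>'>0. \<forall>F' \<theta>'. finite F' \<and> F' \<subseteq> carrier H \<and> \<theta>' > 0 \<longrightarrow>
     (\<exists>(V :: 'v set) \<sigma> \<Omega>'. is_approx H F' \<theta>' (V, \<sigma>) \<and> \<Omega>' \<subseteq> Map_d Y \<beta> dY F' \<theta>' (V, \<sigma>) \<and>
         separated_family \<epsilon>' (dinf dY V) \<Omega>' \<and> exp ((c - \<eta>) * real (card V)) \<le> real (card \<Omega>'))"
proof -
  define kim where "kim A = (\<Union>g\<in>A. k g ` topspace X)" for A
  \<comment> \<open>\<open>exp (\<eta> / 2 * \<Upsilon> A)\<close> bounds the number of families \<open>(k h x)\<close>, \<open>h \<in> A\<close>.\<close>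
  define \<Upsilon> where "\<Upsilon> A = real (card A) * ln (real (card (kim A))) * (2 / \<eta>)" for A
  have \<Upsilon>: "\<Upsilon> A \<ge> 0" for A
  proof -
    have "ln (real m) \<ge> 0" for m :: nat by (cases m) auto
    then show ?thesis using \<eta> by (simp add: \<Upsilon>_def)
  qed
  have "\<forall>A\<in>fin_subsets G. \<Upsilon> A \<ge> 0" using \<Upsilon> by blast
  from SC[unfolded property_SC_def, THEN spec, THEN mp, OF this]
  obtain S where S: "S \<in> sym_fin_subsets G" and SC_T: "\<forall>T\<in>sym_fin_subsets G.
       \<exists>(C::nat) (n::nat) Ss. (\<forall>j\<in>{1..n}. Ss j \<in> sym_fin_subsets G) \<and>
       (\<exists>F\<in>fin_subsets G. \<exists>\<delta>>0.
        \<exists>K \<theta>. finite K \<and> K \<subseteq> carrier G \<and> \<theta> > 0 \<and>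
        (\<forall>(V, \<pi>)\<in>\<S>. is_approx G K \<theta> (V, \<pi>) \<and> Map_d X \<alpha> dX F \<delta> (V, \<pi>) \<noteq> {} \<longrightarrow>
          (\<exists>W Vs. W \<subseteq> V \<and> (\<forall>j\<in>{1..n}. Vs j \<subseteq> V) \<and>
             (\<Sum>j=1..n. \<Upsilon> (Ss j) * (real (card (Vs j)) / real (card V))) \<le> 1 \<and>
             (\<Union>g\<in>S. \<pi> g ` W) = V \<and>
             (\<forall>w1\<in>W. \<forall>w2\<in>W. (\<exists>g\<in>T. \<pi> g w1 = w2) \<longrightarrow>
                connected_by_path \<pi> n Ss Vs C w1 w2))))"
    by (rule bexE)
  have Sf: "finite S" "S \<subseteq> carrier G" using S by (auto simp: sym_fin_subsets_def)
  have KS: "finite (kim S)" "kim S \<subseteq> carrier H"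
    using finite_k_image[OF Sf] k_closed Sf by (auto simp: kim_def)
  have "\<epsilon> / 3 > 0" using \<epsilon> by simp
  from uniform_\<alpha>[OF Sf this] obtain r where r: "r > 0"
    and r_\<alpha>: "\<And>s x y. \<lbrakk>s \<in> S; x \<in> topspace X; y \<in> topspace X; dX x y < r\<rbrakk> \<Longrightarrow> dX (\<alpha> s x) (\<alpha> s y) < \<epsilon> / 3"
    by blast
  \<comment> \<open>Transferred models apply only elements of the finite set \<open>kim S\<close>,
    so one modulus serves all of them.\<close>
  from uniform_\<beta>_\<Phi>_inverse[OF KS r] obtain \<epsilon>' where \<epsilon>': "\<epsilon>' > 0"
    and \<epsilon>'_inv: "\<And>t x y. \<lbrakk>t \<in> kim S; x \<in> topspace X; y \<in> topspace X; dY (\<beta> t (\<Phi> x)) (\<beta> t (\<Phi> y)) < \<epsilon>'\<rbrakk> \<Longrightarrow> dX x y < r"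
    by blast
  have "\<exists>(V :: 'v set) \<sigma> \<Omega>'. is_approx H F' \<theta>' (V, \<sigma>) \<and> \<Omega>' \<subseteq> Map_d Y \<beta> dY F' \<theta>' (V, \<sigma>) \<and>
         separated_family \<epsilon>' (dinf dY V) \<Omega>' \<and> exp ((c - \<eta>) * real (card V)) \<le> real (card \<Omega>')"
    if F': "finite F'" "F' \<subseteq> carrier H" and \<theta>': "\<theta>' > 0" for F' \<theta>'
  proof -
    \<comment> \<open>Products are added for the multiplicativity test, inverses below for the
      injectivity of the induced maps.\<close>
    define F1 where "F1 = F' \<union> (\<lambda>(s, t). s \<otimes>\<^bsub>H\<^esub> t) ` (F' \<times> F')"
    define F where "F = F1 \<union> m_inv H ` F1"
    have F1: "finite F1" "F1 \<subseteq> carrier H" using F' by (auto simp: F1_def)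
    have F: "finite F" "F \<subseteq> carrier H" using F1 by (auto simp: F_def)
    have Finv: "inv\<^bsub>H\<^esub> t \<in> F" if "t \<in> F" for t using that F1 by (auto simp: F_def)
    have F'F: "F' \<subseteq> F" by (auto simp: F_def F1_def)
    have FF: "s \<otimes>\<^bsub>H\<^esub> t \<in> F" if "s \<in> F'" "t \<in> F'" for s t
      using that unfolding F_def F1_def by blast
    define L where "L = (\<Union>t\<in>F. l t ` topspace X)"
    have L: "finite L" "L \<subseteq> carrier G" using finite_l_image[OF F] l_closed F by (auto simp: L_def)
    \<comment> \<open>All elements that may be needed to move one chosen base point in W to another;
      T is its symmetrisation, as property SC requires.\<close>
    define T0 where "T0 = (\<lambda>(b, g, a). inv\<^bsub>G\<^esub> b \<otimes>\<^bsub>G\<^esub> (g \<otimes>\<^bsub>G\<^esub> a)) ` (S \<times> L \<times> S)"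
    define T where "T = insert \<one>\<^bsub>G\<^esub> (T0 \<union> m_inv G ` T0)"
    have T0: "finite T0" "T0 \<subseteq> carrier G" using Sf L by (auto simp: T0_def)
    have T: "T \<in> sym_fin_subsets G" using T0 by (auto simp: T_def sym_fin_subsets_def)
    from bspec[OF SC_T T]
    obtain C n Ss Fs \<delta>s Ks \<theta>s where Ss: "\<forall>j\<in>{1..n}. Ss j \<in> sym_fin_subsets G"
      and Fs: "Fs \<in> fin_subsets G" and \<delta>s: "\<delta>s > 0" and Ks: "finite Ks" "Ks \<subseteq> carrier G" and \<theta>s: "\<theta>s > 0"
      and SC_V: "\<forall>(V, \<pi>)\<in>\<S>. is_approx G Ks \<theta>s (V, \<pi>) \<and> Map_d X \<alpha> dX Fs \<delta>s (V, \<pi>) \<noteq> {} \<longrightarrow>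
          (\<exists>W Vs. W \<subseteq> V \<and> (\<forall>j\<in>{1..n}. Vs j \<subseteq> V) \<and>
             (\<Sum>j=1..n. \<Upsilon> (Ss j) * (real (card (Vs j)) / real (card V))) \<le> 1 \<and>
             (\<Union>g\<in>S. \<pi> g ` W) = V \<and>
             (\<forall>w1\<in>W. \<forall>w2\<in>W. (\<exists>g\<in>T. \<pi> g w1 = w2) \<longrightarrow>
                connected_by_path \<pi> n Ss Vs C w1 w2))"
      by (elim exE bexE conjE) (rule that)
    have Ssf: "finite (Ss j)" "Ss j \<subseteq> carrier G" "Ss j \<noteq> {}" if "j \<in> {1..n}" for j
      using bspec[OF Ss that] by (auto simp: sym_fin_subsets_def)
    define A where "A = (\<Union>j\<in>{1..n}. Ss j)"
    have A: "finite A" "A \<subseteq> carrier G" unfolding A_def using Ssf by (blast intro: finite_UN_I)+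
    define E where "E = {\<one>\<^bsub>G\<^esub>} \<union> S \<union> T \<union> L \<union> A \<union> (\<Union>i\<le>C. words G A i)"
    have Tf: "finite T" "T \<subseteq> carrier G" using T by (auto simp: sym_fin_subsets_def)
    have E: "finite E" "E \<subseteq> carrier G"
    proof -
      show "finite E" using Sf Tf L A finite_words[OF A(1), of G] by (simp add: E_def)
      show "E \<subseteq> carrier G"
        unfolding E_def using Sf Tf L A G.words_closed[OF A(2)] by blast
    qed
    obtain \<rho>1 where \<rho>1: "\<rho>1 > 0" "\<And>g x y. \<lbrakk>g \<in> S \<union> A; x \<in> topspace X; y \<in> topspace X; dX x y < \<rho>1\<rbrakk> \<Longrightarrow> k g x = k g y"
      using locally_constant_k[of "S \<union> A"] Sf A by (metis finite_Un Un_least)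
    from locally_constant_l[OF F] obtain \<rho>2 where \<rho>2: "\<rho>2 > 0"
      "\<And>t x y. \<lbrakk>t \<in> F; x \<in> topspace X; y \<in> topspace X; dX x y < \<rho>2\<rbrakk> \<Longrightarrow> l t x = l t y"
      by blast
    have "\<theta>' / 2 > 0" using \<theta>' by simp
    from uniform_\<beta>_\<Phi>[OF KS this] obtain \<rho>3 where \<rho>3: "\<rho>3 > 0"
      "\<And>t x y. \<lbrakk>t \<in> kim S; x \<in> topspace X; y \<in> topspace X; dX x y < \<rho>3\<rbrakk> \<Longrightarrow> dY (\<beta> t (\<Phi> x)) (\<beta> t (\<Phi> y)) < \<theta>' / 2"
      by blast
    \<comment> \<open>The four bounds serve the separation estimate, the constancy of k, the
      constancy of l, and the equivariance of psi.\<close>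
    define \<rho> where "\<rho> = min (\<epsilon> / 3) (min \<rho>1 (min \<rho>2 \<rho>3))"
    have \<rho>: "\<rho> > 0" "\<rho> \<le> \<epsilon> / 3" "\<rho> \<le> \<rho>1" "\<rho> \<le> \<rho>2" "\<rho> \<le> \<rho>3"
      using \<epsilon> \<rho>1(1) \<rho>2(1) \<rho>3(1) by (auto simp: \<rho>_def)
    obtain D where D: "\<And>x y. \<lbrakk>x \<in> topspace Y; y \<in> topspace Y\<rbrakk> \<Longrightarrow> dY x y \<le> D"
      using compact_metric_bounded[OF compact_Y metric_Y] by metis
    obtain M :: nat and lab where lab: "\<And>x. x \<in> topspace X \<Longrightarrow> 1 \<le> lab x \<and> lab x \<le> M"
      "\<And>x y. \<lbrakk>x \<in> topspace X; y \<in> topspace X; lab x = lab y\<rbrakk> \<Longrightarrow> dX x y < \<epsilon>"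
      using compact_metric_labels[OF compact_X metric_X \<epsilon>] by metis
    have "\<eta> / 2 > 0" using \<eta> by simp
    from card_sparse_le_exp[OF this, of M] obtain \<tau>0 where \<tau>0: "\<tau>0 > 0"
      "\<And>(V::'v set) \<tau>. \<lbrakk>finite V; \<tau> \<le> \<tau>0\<rbrakk> \<Longrightarrow>
        real (card {f \<in> V \<rightarrow>\<^sub>E {..M}. real (card {v\<in>V. f v \<noteq> 0}) \<le> \<tau> * real (card V)})
         \<le> exp (\<eta> / 2 * real (card V))"
      by blast
    define \<tau> where "\<tau> = min \<tau>0 (min (\<theta>' / 2) (\<theta>'\<^sup>2 / (2 * (D\<^sup>2 + 1))))"
    have D1: "2 * (D\<^sup>2 + 1) > 0" by (intro mult_pos_pos add_nonneg_pos) auto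
    have "\<theta>'\<^sup>2 / (2 * (D\<^sup>2 + 1)) > 0" using \<theta>' D1 by (intro divide_pos_pos) auto
    then have "\<tau> > 0" using \<tau>0(1) \<theta>' by (simp add: \<tau>_def)
    moreover have "\<tau> \<le> \<tau>0" "\<tau> \<le> \<theta>' / 2" "\<tau> \<le> \<theta>'\<^sup>2 / (2 * (D\<^sup>2 + 1))"
      unfolding \<tau>_def by (simp_all only: min.cobounded1 min.coboundedI2 min.cobounded2)
    ultimately have \<tau>: "\<tau> > 0" "\<tau> \<le> \<tau>0" "2 * \<tau> \<le> \<theta>'" "\<tau> \<le> \<theta>'\<^sup>2 / (2 * (D\<^sup>2 + 1))"
      by simp_all
    have \<tau>D: "sqrt ((\<theta>' / 2)\<^sup>2 + \<tau> * D\<^sup>2) \<le> \<theta>'"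
    proof (rule real_le_lsqrt)
      have "\<tau> * D\<^sup>2 \<le> \<tau> * (D\<^sup>2 + 1)" using \<tau> by (intro mult_left_mono) auto
      also have "\<dots> \<le> \<theta>'\<^sup>2 / (2 * (D\<^sup>2 + 1)) * (D\<^sup>2 + 1)" using \<tau> by (intro mult_right_mono) auto
      also have "\<dots> = \<theta>'\<^sup>2 / 2"
      proof -
        have "a / (2 * x) * x = a / 2" if "2 * x > 0" for a x :: real using that by simp
        then show ?thesis using D1 .
      qed
      finally have "\<tau> * D\<^sup>2 \<le> \<theta>'\<^sup>2 / 2" .
      moreover have "(\<theta>' / 2)\<^sup>2 \<le> \<theta>'\<^sup>2 / 2" by (simp add: power_divide)
      ultimately show "(\<theta>' / 2)\<^sup>2 + \<tau> * D\<^sup>2 \<le> \<theta>'\<^sup>2"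
        by (metis add_mono field_sum_of_halves)
    qed (use \<theta>' in auto)
    obtain \<theta>1 \<delta>1 where small: "\<theta>1 > 0" "\<delta>1 > 0"
      "(1 + real (card S)) * (2 * (real (card E))\<^sup>2 * \<theta>1 + real (card E) * (\<delta>1\<^sup>2 / \<rho>\<^sup>2)) \<le> \<tau>"
      by (rule small_parameters[of "real (card E)" "real (card S)" \<tau> \<rho>]) (use \<tau> \<rho> in auto)
    \<comment> \<open>Unions and minima make one approximation satisfy both the accuracy on E and
      the entry conditions of property SC.\<close>
    have "\<exists>V \<pi> \<Omega>. (V, \<pi>) \<in> \<S> \<and> is_approx G (E \<union> Ks) (min \<theta>1 \<theta>s) (V, \<pi>) \<and> \<Omega> \<subseteq> Map_d X \<alpha> dX (E \<union> Fs) (min \<delta>1 \<delta>s) (V, \<pi>) \<and>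
         separated_family \<epsilon> (dinf dX V) \<Omega> \<and> exp (c * real (card V)) < real (card \<Omega>)"
      by (rule many) (use E Fs Ks small \<delta>s \<theta>s in \<open>auto simp: fin_subsets_def\<close>)
    then obtain V \<pi> \<Omega> where VS: "(V, \<pi>) \<in> \<S>" and appr: "is_approx G (E \<union> Ks) (min \<theta>1 \<theta>s) (V, \<pi>)"
      and \<Omega>: "\<Omega> \<subseteq> Map_d X \<alpha> dX (E \<union> Fs) (min \<delta>1 \<delta>s) (V, \<pi>)"
      and sep: "separated_family \<epsilon> (dinf dX V) \<Omega>" and big: "exp (c * real (card V)) < real (card \<Omega>)"
      by blast
    have V: "finite V" "V \<noteq> {}" and \<pi>: "\<And>g. g \<in> carrier G \<Longrightarrow> \<pi> g permutes V"
      using appr by (auto simp: is_approx_def sofic_approx_def)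
    have N: "real (card V) > 0" using V by (simp add: card_gt_0_iff)
    have apprE: "is_approx G E \<theta>1 (V, \<pi>)" and apprK: "is_approx G Ks \<theta>s (V, \<pi>)"
      by (rule is_approx_mono[OF appr]; simp)+
    have \<Omega>E: "\<Omega> \<subseteq> Map_d X \<alpha> dX E \<delta>1 (V, \<pi>)" and \<Omega>F: "\<Omega> \<subseteq> Map_d X \<alpha> dX Fs \<delta>s (V, \<pi>)"
      by (rule subset_trans[OF \<Omega> Map_d_mono]; simp)+
    have \<Omega>f: "finite \<Omega>" using sep by (simp add: separated_family_def)
    have \<Omega>ne: "\<Omega> \<noteq> {}"
    proof
      assume "\<Omega> = {}" then show False using big exp_gt_zero[of "c * real (card V)"] by simp
    qed
    then have Mne: "Map_d X \<alpha> dX Fs \<delta>s (V, \<pi>) \<noteq> {}" using \<Omega>F by blast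
    from bspec[OF SC_V VS, unfolded case_prod_conv, THEN mp, OF conjI[OF apprK Mne]]
    obtain W Vs where WV: "W \<subseteq> V" and Vs: "\<forall>j\<in>{1..n}. Vs j \<subseteq> V"
      and sum1: "(\<Sum>j=1..n. \<Upsilon> (Ss j) * (real (card (Vs j)) / real (card V))) \<le> 1"
      and cover: "(\<Union>g\<in>S. \<pi> g ` W) = V"
      and path: "\<forall>w1\<in>W. \<forall>w2\<in>W. (\<exists>g\<in>T. \<pi> g w1 = w2) \<longrightarrow> connected_by_path \<pi> n Ss Vs C w1 w2"
      by (elim exE conjE) (rule that)
    have "\<exists>s u. s \<in> S \<and> u \<in> W \<and> \<pi> s u = v" if "v \<in> V" for v using that cover by blast
    then obtain sh w where shw: "\<And>v. v \<in> V \<Longrightarrow> sh v \<in> S \<and> w v \<in> W \<and> \<pi> (sh v) (w v) = v" by metis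
    have \<Omega>X: "\<phi> v \<in> topspace X" if "\<phi> \<in> \<Omega>" "v \<in> V" for \<phi> v
      using that \<Omega>E by (fastforce simp: Map_d_def)
    define gd where "gd \<phi> v \<longleftrightarrow> good E \<rho> \<pi> \<phi> v \<and> good E \<rho> \<pi> \<phi> (w v)" for \<phi> v
    have bad: "real (card {v\<in>V. \<not> gd \<phi> v}) \<le> \<tau> * real (card V)" if \<phi>: "\<phi> \<in> \<Omega>" for \<phi>
    proof -
      let ?B = "{v\<in>V. \<not> good E \<rho> \<pi> \<phi> v}"
      let ?b = "(2 * (real (card E))\<^sup>2 * \<theta>1 + real (card E) * (\<delta>1\<^sup>2 / \<rho>\<^sup>2)) * real (card V)"
      have b: "real (card ?B) \<le> ?b"
        by (rule card_not_good_le[OF E(1) apprE _ _ \<rho>(1)]) (use small \<phi> \<Omega>E in auto)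
      have "real (card (\<Union>s\<in>S. \<pi> s ` ?B)) \<le> real (card S) * ?b"
      proof (rule card_UN_le_mult[OF Sf(1)])
        fix s assume "s \<in> S"
        have "card (\<pi> s ` ?B) \<le> card ?B" using V by (intro card_image_le) simp
        then show "real (card (\<pi> s ` ?B)) \<le> ?b" using b by linarith
      qed
      \<comment> \<open>The map w may send many vertices to the same bad one, but v is then the
        translate of that vertex by an element of S; hence the factor
        \<open>1 + card S\<close>.\<close>
      moreover have "{v\<in>V. \<not> gd \<phi> v} \<subseteq> ?B \<union> (\<Union>s\<in>S. \<pi> s ` ?B)"
      proof
        fix v assume v: "v \<in> {v\<in>V. \<not> gd \<phi> v}"
        show "v \<in> ?B \<union> (\<Union>s\<in>S. \<pi> s ` ?B)"
        proof (cases "good E \<rho> \<pi> \<phi> v")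
          case True
          then have "w v \<in> ?B" using v shw WV by (auto simp: gd_def)
          then have "\<pi> (sh v) (w v) \<in> \<pi> (sh v) ` ?B" by (rule imageI)
          then show ?thesis using shw v by auto
        qed (use v in auto)
      qed
      then have "card {v\<in>V. \<not> gd \<phi> v} \<le> card (?B \<union> (\<Union>s\<in>S. \<pi> s ` ?B))"
        using V Sf by (intro card_mono) auto
      moreover have "card (?B \<union> (\<Union>s\<in>S. \<pi> s ` ?B)) \<le> card ?B + card (\<Union>s\<in>S. \<pi> s ` ?B)" by (rule card_Un_le)
      ultimately have "real (card {v\<in>V. \<not> gd \<phi> v}) \<le> ?b + real (card S) * ?b" using b by linarith
      also have "\<dots> = (1 + real (card S)) * (2 * (real (card E))\<^sup>2 * \<theta>1 + real (card E) * (\<delta>1\<^sup>2 / \<rho>\<^sup>2)) * real (card V)"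
        by (simp only: distrib_right mult_1 mult.assoc)
      also have "\<dots> \<le> \<tau> * real (card V)" using small(3) by (intro mult_right_mono) auto
      finally show ?thesis .
    qed
    \<comment> \<open>Off the good points nothing is known about \<open>\<phi>\<close>, so its approximate value is recorded in the class.\<close>
    define fl where "fl \<phi> = (\<lambda>v\<in>V. if gd \<phi> v then 0 else lab (\<phi> v))" for \<phi>
    define In where "In \<phi> = (\<lambda>j\<in>{1..n}. \<lambda>v\<in>Vs j. \<lambda>h\<in>Ss j. k h (\<phi> v))" for \<phi>
    define CF where "CF = {f \<in> V \<rightarrow>\<^sub>E {..M}. real (card {v\<in>V. f v \<noteq> 0}) \<le> \<tau> * real (card V)}"
    define CI where "CI = PiE {1..n} (\<lambda>j. Vs j \<rightarrow>\<^sub>E (Ss j \<rightarrow>\<^sub>E kim (Ss j)))"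
    have fl_pos: "fl \<phi> v = 0 \<longleftrightarrow> gd \<phi> v" if "\<phi> \<in> \<Omega>" "v \<in> V" for \<phi> v
      using lab(1)[OF \<Omega>X[OF that]] that by (auto simp: fl_def)
    have fl: "fl \<phi> \<in> CF" if \<phi>: "\<phi> \<in> \<Omega>" for \<phi>
    proof -
      have "{v\<in>V. fl \<phi> v \<noteq> 0} = {v\<in>V. \<not> gd \<phi> v}" 
        by (intro Collect_cong conj_cong refl arg_cong[where f = Not] fl_pos[OF \<phi>])
      then show ?thesis using bad[OF \<phi>] lab(1) \<Omega>X[OF \<phi>] by (auto simp: CF_def fl_def)
    qed
    have In: "In \<phi> \<in> CI" if \<phi>: "\<phi> \<in> \<Omega>" for \<phi>
    proof -
      have "k h (\<phi> v) \<in> kim (Ss j)" if "j \<in> {1..n}" "v \<in> Vs j" "h \<in> Ss j" for j v h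
      proof -
        have "v \<in> V" using bspec[OF Vs that(1)] that(2) by (rule subsetD)
        then show ?thesis unfolding kim_def by (intro UN_I[OF that(3)] imageI \<Omega>X[OF \<phi>])
      qed
      then show ?thesis by (auto simp: CI_def In_def)
    qed
    have finCF: "finite CF"
      by (rule finite_subset[of _ "V \<rightarrow>\<^sub>E {..M}"]) (use V in \<open>auto simp: CF_def intro: finite_PiE\<close>)
    have kimSs: "finite (kim (Ss j))" "card (kim (Ss j)) > 0" if "j \<in> {1..n}" for j
    proof -
      show 1: "finite (kim (Ss j))" unfolding kim_def using Ssf[OF that] by (intro finite_k_image)
      obtain \<phi> v where "\<phi> \<in> \<Omega>" "v \<in> V" using \<Omega>ne V by blast
      then have "topspace X \<noteq> {}" using \<Omega>X by blast
      then have "kim (Ss j) \<noteq> {}" unfolding kim_def using Ssf[OF that] by blast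
      then show "card (kim (Ss j)) > 0" using 1 by (simp add: card_gt_0_iff)
    qed
    have finVs: "finite (Vs j)" if "j \<in> {1..n}" for j using bspec[OF Vs that] V finite_subset by blast
    have finCI: "finite CI" unfolding CI_def
      using kimSs Ssf finVs by (intro finite_PiE) auto
    have cCF: "real (card CF) \<le> exp (\<eta> / 2 * real (card V))"
      unfolding CF_def by (rule \<tau>0(2)[OF V(1) \<tau>(2)])
    have cCI: "real (card CI) \<le> exp (\<eta> / 2 * real (card V))"
    proof -
      have "real (card CI) = exp (\<Sum>j\<in>{1..n}. real (card (Vs j)) * (real (card (Ss j)) * ln (real (card (kim (Ss j))))))"
        unfolding CI_def using kimSs Ssf finVs by (intro card_PiE_nested) auto
      also have "(\<Sum>j\<in>{1..n}. real (card (Vs j)) * (real (card (Ss j)) * ln (real (card (kim (Ss j)))))) =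
         \<eta> / 2 * real (card V) * (\<Sum>j=1..n. \<Upsilon> (Ss j) * (real (card (Vs j)) / real (card V)))"
        unfolding sum_distrib_left
      proof (intro sum.cong refl)
        fix j
        have "\<eta> / 2 * real (card V) * (a * b * (2 / \<eta>) * (d / real (card V))) = d * (a * b)" for a b d
          using \<eta> N by simp
        then show "real (card (Vs j)) * (real (card (Ss j)) * ln (real (card (kim (Ss j))))) =
          \<eta> / 2 * real (card V) * (\<Upsilon> (Ss j) * (real (card (Vs j)) / real (card V)))"
          by (simp only: \<Upsilon>_def)
      qed
      \<comment> \<open>The budget of property SC bounds the weighted sum by 1.\<close>
      also have "exp \<dots> \<le> exp (\<eta> / 2 * real (card V) * 1)"
        using \<eta> N sum1 by (intro exp_le_cancel_iff[THEN iffD2] mult_left_mono) auto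
      finally show ?thesis by simp
    qed
    obtain \<phi>0 where \<phi>0: "\<phi>0 \<in> \<Omega>"
      and fibre: "card \<Omega> \<le> card (CF \<times> CI) * card {\<phi>\<in>\<Omega>. (fl \<phi>, In \<phi>) = (fl \<phi>0, In \<phi>0)}"
      by (rule pigeonhole_fibre[OF \<Omega>f \<Omega>ne, of "CF \<times> CI" "\<lambda>\<phi>. (fl \<phi>, In \<phi>)"])
        (use finCF finCI fl In in auto)
    define \<Omega>1 where "\<Omega>1 = {\<phi>\<in>\<Omega>. (fl \<phi>, In \<phi>) = (fl \<phi>0, In \<phi>0)}"
    \<comment> \<open>Each of the two records costs \<eta>/2 in the exponent.\<close>
    have count: "exp ((c - \<eta>) * real (card V)) \<le> real (card \<Omega>1)"
    proof -
      have "exp (c * real (card V)) \<le> real (card \<Omega>)" using big by simp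
      also have "\<dots> \<le> real (card CF) * real (card CI) * real (card \<Omega>1)"
        using of_nat_mono[OF fibre, where 'a = real] by (simp add: card_cartesian_product \<Omega>1_def)
      also have "\<dots> \<le> exp (\<eta> / 2 * real (card V)) * exp (\<eta> / 2 * real (card V)) * real (card \<Omega>1)"
        using cCF cCI by (intro mult_right_mono mult_mono) auto
      also have "\<dots> = exp (\<eta> * real (card V)) * real (card \<Omega>1)"
        by (simp flip: exp_add)
      finally have "exp (c * real (card V)) / exp (\<eta> * real (card V)) \<le> real (card \<Omega>1)"
        by (simp add: field_simps)
      then show ?thesis by (simp add: left_diff_distrib exp_diff)
    qed
    interpret tr: sofic_transfer G H X Y \<alpha> \<beta> dX dY \<Phi> \<Psi> \<kappa> \<mu> V \<pi> E S T \<rho> F sh w C n Ss Vs \<phi>0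
    proof unfold_locales
      show "finite V" "V \<noteq> {}" by fact+
      show "\<pi> g permutes V" if "g \<in> carrier G" for g using \<pi> that .
      show "E \<subseteq> carrier G" by fact
      show "\<one>\<^bsub>G\<^esub> \<in> E" "S \<subseteq> E" "T \<subseteq> E" by (auto simp: E_def)
      show "F \<subseteq> carrier H" by fact
      show "inv\<^bsub>H\<^esub> t \<in> F" if "t \<in> F" for t using Finv that .
      show "l t x \<in> E" if "t \<in> F" "x \<in> topspace X" for t x
        using that by (auto simp: E_def L_def)
      show "inv\<^bsub>G\<^esub> b \<otimes>\<^bsub>G\<^esub> (l t x \<otimes>\<^bsub>G\<^esub> a) \<in> T" if "t \<in> F" "x \<in> topspace X" "a \<in> S" "b \<in> S" for t x a b
      proof -
        have "(b, l t x, a) \<in> S \<times> L \<times> S" using that by (auto simp: L_def)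
        then have "(\<lambda>(b, g, a). inv\<^bsub>G\<^esub> b \<otimes>\<^bsub>G\<^esub> (g \<otimes>\<^bsub>G\<^esub> a)) (b, l t x, a) \<in> T0" unfolding T0_def by (rule imageI)
        then show ?thesis by (simp add: T_def)
      qed
      show "Ss j \<subseteq> E" if "j \<in> {1..n}" for j using that by (auto simp: E_def A_def)
      show "words G (\<Union>j\<in>{1..n}. Ss j) i \<subseteq> E" if "i \<le> C" for i
        using that by (auto simp: E_def A_def)
      show "k g x = k g y" if "g \<in> S \<union> (\<Union>j\<in>{1..n}. Ss j)" "x \<in> topspace X" "y \<in> topspace X" "dX x y < \<rho>" for g x y
        by (rule \<rho>1(2)) (use that \<rho>(3) in \<open>auto simp: A_def\<close>)
      show "l t x = l t y" if "t \<in> F" "x \<in> topspace X" "y \<in> topspace X" "dX x y < \<rho>" for t x y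
        by (rule \<rho>2(2)) (use that \<rho>(4) in auto)
      show "sh v \<in> S" if "v \<in> V" for v using shw that by blast
      show "w v \<in> V" if "v \<in> V" for v using shw that WV by blast
      show "\<pi> (sh v) (w v) = v" if "v \<in> V" for v using shw that by blast
      show "connected_by_path \<pi> n Ss Vs C (w v) (w u)" if "v \<in> V" "u \<in> V" "q \<in> T" "\<pi> q (w v) = w u" for v u q
        using path shw that by blast
      show "\<phi>0 v \<in> topspace X" if "v \<in> V" for v using \<Omega>X[OF \<phi>0 that] .
    qed
    have Q: "tr.Q = {v\<in>V. gd \<phi>0 v}" by (simp add: tr.Q_def gd_def)
    have "V - tr.Q = {v\<in>V. \<not> gd \<phi>0 v}" unfolding Q by blast
    then have cQ: "real (card (V - tr.Q)) \<le> \<tau> * real (card V)" using bad[OF \<phi>0] by simp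
    have tt: "tr.tt u \<in> kim S" if "u \<in> V" for u
      using shw[OF that] WV \<Omega>X[OF \<phi>0] by (auto simp: tr.tt_def kim_def)
    have ag: "tr.agrees \<phi>" if \<phi>: "\<phi> \<in> \<Omega>1" for \<phi>
    proof -
      have "k h (\<phi> v) = k h (\<phi>0 v)" if "j \<in> {1..n}" "v \<in> Vs j" "h \<in> Ss j" for j v h
      proof -
        have "In \<phi> j v h = In \<phi>0 j v h" using \<phi> by (simp add: \<Omega>1_def)
        then show ?thesis using that by (simp add: In_def)
      qed
      then show ?thesis using \<phi> \<Omega>X unfolding tr.agrees_def by (auto simp: \<Omega>1_def)
    qed
    have fl_eq: "fl \<phi> = fl \<phi>0" and mem: "\<phi> \<in> \<Omega>" if "\<phi> \<in> \<Omega>1" for \<phi>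
      using that by (auto simp: \<Omega>1_def)
    \<comment> \<open>The zeros of the recorded function are exactly the good vertices, so all
      models of the class share the set Q of \<open>\<phi>0\<close>.\<close>
    have gQ: "gd \<phi> v \<longleftrightarrow> v \<in> tr.Q" if \<phi>: "\<phi> \<in> \<Omega>1" and v: "v \<in> V" for \<phi> v
      using fl_pos[OF mem[OF \<phi>] v] fl_pos[OF \<phi>0 v] fl_eq[OF \<phi>] v unfolding Q by simp
    have gw: "good E \<rho> \<pi> \<phi> (w v)" if "\<phi> \<in> \<Omega>1" "v \<in> tr.Q" for \<phi> v
      using gQ[OF that(1), of v] that(2) unfolding Q gd_def by blast
    obtain \<sigma> where \<sigma>: "\<And>t. \<sigma> t permutes V" "\<And>t v. \<lbrakk>t \<in> F; v \<in> tr.Q\<rbrakk> \<Longrightarrow> \<sigma> t v = \<pi> (l t (\<phi>0 v)) v"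
      using tr.sigma_exists by blast
    have 1: "is_approx H F' \<theta>' (V, \<sigma>)"
      by (rule tr.is_approx_sigma[OF \<sigma> F'F FF cQ \<tau>(3)])
    have 2: "tr.psi \<phi> \<in> Map_d Y \<beta> dY F' \<theta>' (V, \<sigma>)" if "\<phi> \<in> \<Omega>1" for \<phi>
      by (rule tr.psi_in_Map_d[where e = "\<theta>' / 2" and D = D, OF \<sigma> F'F ag[OF that] gw[OF that] _ D cQ \<tau>D])
        (use \<rho>3(2)[OF tt] \<rho>(5) in auto)
    have far: "\<epsilon>' \<le> dinf dY V (tr.psi \<phi>) (tr.psi \<psi>)" if \<phi>: "\<phi> \<in> \<Omega>1" and \<psi>: "\<psi> \<in> \<Omega>1" and ne: "\<phi> \<noteq> \<psi>" for \<phi> \<psi>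
    proof (rule ccontr)
      assume "\<not> ?thesis"
      then have close: "dinf dY V (tr.psi \<phi>) (tr.psi \<psi>) < \<epsilon>'" by simp
      have off: "dX (\<phi> v) (\<psi> v) < \<epsilon>" if "v \<in> V" "v \<notin> tr.Q" for v
      proof (rule lab(2))
        show "\<phi> v \<in> topspace X" "\<psi> v \<in> topspace X" using \<Omega>X mem \<phi> \<psi> that by auto
        have "fl \<phi> v = fl \<psi> v" using fl_eq[OF \<phi>] fl_eq[OF \<psi>] by simp
        then show "lab (\<phi> v) = lab (\<psi> v)" using gQ[OF \<phi>] gQ[OF \<psi>] that by (simp add: fl_def)
      qed
      have "dinf dX V \<phi> \<psi> < \<epsilon>"
        by (rule tr.dinf_less_if_psi_close[OF ag[OF \<phi>] gw[OF \<phi>] ag[OF \<psi>] gw[OF \<psi>] \<epsilon>'_inv[OF tt] r_\<alpha> \<rho>(2) off close])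
      moreover have "\<epsilon> \<le> dinf dX V \<phi> \<psi>"
        using sep mem \<phi> \<psi> ne by (simp add: separated_family_def)
      ultimately show False by simp
    qed
    \<comment> \<open>Equal images would be at distance 0, below the new scale; hence the family
      keeps its size.\<close>
    have "inj_on tr.psi \<Omega>1"
    proof (rule inj_onI, rule ccontr)
      fix \<phi> \<psi> assume *: "\<phi> \<in> \<Omega>1" "\<psi> \<in> \<Omega>1" "tr.psi \<phi> = tr.psi \<psi>" "\<phi> \<noteq> \<psi>"
      have "dinf dY V (tr.psi \<phi>) (tr.psi \<psi>) < \<epsilon>'"
        using \<epsilon>' *(3) tr.psi_closed[OF ag[OF *(2)]] by (simp add: dinf_less_iff[OF V])
      then show False using far[OF *(1,2,4)] by simp
    qed
    then have "card (tr.psi ` \<Omega>1) = card \<Omega>1" by (rule card_image)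
    moreover have "separated_family \<epsilon>' (dinf dY V) (tr.psi ` \<Omega>1)"
      using far \<Omega>f by (auto simp: separated_family_def \<Omega>1_def)
    ultimately show ?thesis
      using 1 2 count by (intro exI[of _ V] exI[of _ \<sigma>] exI[of _ "tr.psi ` \<Omega>1"]) auto
  qed
  then show ?thesis using \<epsilon>' by blast
qed

end

section \<open>Comparison of the entropies\<close>

theorem theorem4p1:
  fixes G :: "('g, 'm) monoid_scheme" and H :: "('h, 'n) monoid_scheme"
    and X :: "'x topology" and Y :: "'y topology"
    and \<alpha> :: "'g \<Rightarrow> 'x \<Rightarrow> 'x" and \<beta> :: "'h \<Rightarrow> 'y \<Rightarrow> 'y"
    and dX :: "'x \<Rightarrow> 'x \<Rightarrow> real" and dY :: "'y \<Rightarrow> 'y \<Rightarrow> real"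
    and \<S> :: "('g, 'v) approx set" and \<Sigma> :: "nat \<Rightarrow> ('g, 'v) approx"
  assumes "group G" and "countable (carrier G)"
    and "group H" and "countable (carrier H)"
    and "compact_space X" and "compatible_metric X dX"
    and "compact_space Y" and "compatible_metric Y dY"
    and "continuous_action G X \<alpha>" and "topologically_free G X \<alpha>"
    and "continuous_action H Y \<beta>" and "topologically_free H Y \<beta>"
    and "continuously_orbit_equivalent G X \<alpha> H Y \<beta>"
    and "\<forall>\<sigma>\<in>\<S>. sofic_approx G \<sigma>"
    and "property_SC G X \<alpha> dX \<S>"
    and "sofic_approx_seq G \<Sigma>" and "\<forall>k. \<Sigma> k \<in> \<S>"
  shows "max_sofic_entropy H Y \<beta> dY \<ge> sofic_entropy G X \<alpha> dX \<Sigma>"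
proof -
  obtain \<Phi> \<Psi> \<kappa> \<mu> where "homeomorphic_maps X Y \<Phi> \<Psi>"
    "continuous_map (prod_topology (discrete_topology (carrier G)) X) (discrete_topology (carrier H)) \<kappa>"
    "continuous_map (prod_topology (discrete_topology (carrier H)) Y) (discrete_topology (carrier G)) \<mu>"
    "\<forall>g\<in>carrier G. \<forall>x\<in>topspace X. \<Phi> (\<alpha> g x) = \<beta> (\<kappa> (g, x)) (\<Phi> x)"
    "\<forall>t\<in>carrier H. \<forall>y\<in>topspace Y. \<Psi> (\<beta> t y) = \<alpha> (\<mu> (t, y)) (\<Psi> y)"
    using assms(13) unfolding continuously_orbit_equivalent_def by blast
  then interpret orbit_equivalence G H X Y \<alpha> \<beta> dX dY \<Phi> \<Psi> \<kappa> \<mu>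
    using assms by (intro orbit_equivalence.intro orbit_equivalence_axioms.intro) auto
  have le: "ereal (c - \<eta>) \<le> max_sofic_entropy H Y \<beta> dY"
    if c: "ereal c < sofic_entropy G X \<alpha> dX \<Sigma>" and \<eta>: "\<eta> > 0" for c \<eta> :: real
  proof -
    from less_sofic_entropyD[OF c assms(16)] obtain \<epsilon> where \<epsilon>: "\<epsilon> > 0" and many:
      "\<forall>F \<delta> K \<theta>. finite F \<and> F \<subseteq> carrier G \<and> \<delta> > 0 \<and> finite K \<and> K \<subseteq> carrier G \<and> \<theta> > 0 \<longrightarrow>
       (\<exists>k \<Omega>. is_approx G K \<theta> (\<Sigma> k) \<and> \<Omega> \<subseteq> Map_d X \<alpha> dX F \<delta> (\<Sigma> k) \<and>
         separated_family \<epsilon> (dinf dX (fst (\<Sigma> k))) \<Omega> \<and>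
         exp (c * real (card (fst (\<Sigma> k)))) < real (card \<Omega>))"
      by (elim exE conjE)
    have "\<exists>V \<pi> \<Omega>. (V, \<pi>) \<in> \<S> \<and> is_approx G K \<theta> (V, \<pi>) \<and> \<Omega> \<subseteq> Map_d X \<alpha> dX F \<delta> (V, \<pi>) \<and>
         separated_family \<epsilon> (dinf dX V) \<Omega> \<and> exp (c * real (card V)) < real (card \<Omega>)"
      if FK: "finite F" "F \<subseteq> carrier G" "\<delta> > 0" "finite K" "K \<subseteq> carrier G" "\<theta> > 0" for F \<delta> K \<theta>
    proof -
      obtain k \<Omega> where *: "is_approx G K \<theta> (\<Sigma> k)" "\<Omega> \<subseteq> Map_d X \<alpha> dX F \<delta> (\<Sigma> k)"
         "separated_family \<epsilon> (dinf dX (fst (\<Sigma> k))) \<Omega>"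
         "exp (c * real (card (fst (\<Sigma> k)))) < real (card \<Omega>)"
        using many[THEN spec, THEN spec, THEN spec, THEN spec, THEN mp, of F \<delta> K \<theta>] FK by blast
      have "\<Sigma> k \<in> \<S>" using assms(17) by blast
      with * show ?thesis
        by (intro exI[of _ "fst (\<Sigma> k)"] exI[of _ "snd (\<Sigma> k)"] exI[of _ \<Omega>]) simp
    qed
    from transfer_separated_families[OF assms(15) \<epsilon> \<eta> this]
    obtain \<epsilon>' where \<epsilon>': "\<epsilon>' > 0" and tr: "\<forall>F' \<theta>'. finite F' \<and> F' \<subseteq> carrier H \<and> \<theta>' > 0 \<longrightarrow>
     (\<exists>(V :: 'v set) \<sigma> \<Omega>'. is_approx H F' \<theta>' (V, \<sigma>) \<and> \<Omega>' \<subseteq> Map_d Y \<beta> dY F' \<theta>' (V, \<sigma>) \<and>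
         separated_family \<epsilon>' (dinf dY V) \<Omega>' \<and> exp ((c - \<eta>) * real (card V)) \<le> real (card \<Omega>'))"
      by blast
    show ?thesis
    proof (rule le_max_sofic_entropy[OF assms(3,4) \<epsilon>'])
      fix F and \<theta> :: real assume F: "finite F" "F \<subseteq> carrier H" "\<theta> > 0"
      then obtain V :: "'v set" and \<sigma> \<Omega>' where *: "is_approx H F \<theta> (V, \<sigma>)" "\<Omega>' \<subseteq> Map_d Y \<beta> dY F \<theta> (V, \<sigma>)"
         "separated_family \<epsilon>' (dinf dY V) \<Omega>'" "exp ((c - \<eta>) * real (card V)) \<le> real (card \<Omega>')"
        using tr by blast
      show "\<exists>(A::('h, nat) approx) \<Omega>. is_approx H F \<theta> A \<and> \<Omega> \<subseteq> Map_d Y \<beta> dY F \<theta> A \<and>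
         separated_family \<epsilon>' (dinf dY (fst A)) \<Omega> \<and>
         exp ((c - \<eta>) * real (card (fst A))) \<le> real (card \<Omega>)"
        using relabel_approx[OF assms(3) F(2) *(1-3)] *(4) by metis
    qed
  qed
  have "ereal c \<le> max_sofic_entropy H Y \<beta> dY" if "ereal c < sofic_entropy G X \<alpha> dX \<Sigma>" for c
  proof (rule ereal_le_epsilon2)
    fix \<eta> :: real assume "0 < \<eta>"
    from le[OF that this] have "ereal (c - \<eta>) + ereal \<eta> \<le> max_sofic_entropy H Y \<beta> dY + ereal \<eta>"
      by (rule add_right_mono)
    then show "ereal c \<le> max_sofic_entropy H Y \<beta> dY + ereal \<eta>" by simp
  qed
  \<comment> \<open>A gap between the two entropies would contain a real number c; this treats
    infinite values as well.\<close>
  then show ?thesis using ereal_dense2 by (metis linorder_not_le)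
qed

end
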